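(* Let $F_N$ be a free group of finite rank $N\ge 2$, and let $T_0$ and $T_1$ be two $\mathbb R$-trees, with metrics $d_0$ and $d_1$, with very small actions of $F_N$ by isometries, with dense orbits, such that $L^2(T_0)=L^2(T_1)$. Let $f:\widehat T_0^{\mathrm{obs}}\to\widehat T_1^{\mathrm{obs}}$ be the $F_N$-equivariant homeomorphism satisfying $f\circ\mathcal Q_0=\mathcal Q_1$. Use $f$ to identify $\widehat T_0^{\mathrm{obs}}$ with $\widehat T_1^{\mathrm{obs}}$, and hence the interior trees $\overset{\circ}{T}_0$ and $\overset{\circ}{T}_1$ with a single set $\overset{\circ}{T}$, on which both metrics $d_0$ and $d_1$ are defined. For $\lambda\in[0,1]$ let $\overset{\circ}{T}_\lambda$ be the set $\overset{\circ}{T}$ equipped with the metric $$d_\lambda=\lambda d_1+(1-\lambda)d_0 .$$ Then for every $\lambda\in[0,1]$ the metric space $\overset{\circ}{T}_\lambda$ is an $\mathbb R$-tree.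
   Context: An $\mathbb R$-tree $T$ is a metric space which is $0$-hyperbolic (in Gromov's sense) and geodesic; equivalently, any two points $P,Q$ are joined by a unique arc $[P,Q]$, and this arc is geodesic (isometric to an interval of $\mathbb R$). $\overline T$ is its metric completion (again an $\mathbb R$-tree), $\partial T$ its Gromov boundary (rays $\mathbb R_{\ge 0}\to T$, two rays being identified iff their images differ only in a compact subset of $T$), and $\widehat T=\overline T\cup\partial T$. For $P,Q\in\widehat T$, $[P,Q]\subset\widehat T$ is the (possibly infinite or bi-infinite) geodesic arc joining $P$ to $Q$, endpoints included. The metric topology on $\widehat T$ restricts to the metric topology on the open subset $\overline T$, and a neighborhood basis of a point of $\partial T$ represented by a ray $\rho$ is given by the connected components of $\widehat T\smallsetminus\{P\}$, $P\in T$, having non-compact intersection with the image of $\rho$. For distinct $P,Q\in\widehat T$, the direction $\mathrm{dir}_P(Q)$ is the connected component of $\widehat T\smallsetminus\{P\}$ containing $Q$ (i.e. the set of $R\neq P$ with $P\notin[Q,R]$). The observers' topology on $\widehat T$ is the topology having the set of all directions as a subbasis; $\widehat T^{\mathrm{obs}}$ denotes $\widehat T$ with this topology. A point $P\in\widehat T$ is extremal if $T\smallsetminus\{P\}$ is connected, equivalently if $P$ does not lie in $[Q,R]\smallsetminus\{Q,R\}$ for any geodesic segment $[Q,R]$. All points of $\partial T$ and of $\overline T\smallsetminus T$ are extremal. The interior tree $\overset{\circ}{T}$ is the set of non-extremal points of $T$. Extremal points are characterized topologically in $\widehat T^{\mathrm{obs}}$, so a homeomorphism $\widehat T_0^{\mathrm{obs}}\to\widehat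 T_1^{\mathrm{obs}}$ maps $\overset{\circ}{T}_0$ bijectively onto $\overset{\circ}{T}_1$. The action is very small if stabilizers of non-degenerate arcs are trivial or maximal cyclic and stabilizers of non-degenerate tripods are trivial; with dense orbits if some (hence every) orbit of points is dense in $T$. Inferior limit: for a sequence $(P_n)$ in $\widehat T$ and $Q\in\widehat T$, $\bigcap_{n\ge m}[Q,P_n]=[Q,R_m]$ for some $R_m\in\widehat T$; these segments increase with $m$, and $\liminf_{Q,\,n\to\infty}P_n:=\lim_{m\to\infty}R_m$ (limit in the metric topology of $\widehat T$). Map $\mathcal Q$: $\partial F_N$ is the Gromov boundary of $F_N$. For $T$ with a very small $F_N$-action with dense orbits, and $X\in\partial F_N$, put $\mathcal Q(X)=\liminf_{P,\,i\to\infty}w_iP\in\widehat T$, for any sequence $(w_i)$ in $F_N$ converging to $X$ and any $P\in T$; it is known that the result does not depend on these choices. $\mathcal Q_0,\mathcal Q_1$ denote the maps for $T_0,T_1$; they are surjective. Dual algebraic lamination: $\partial^2F_N=(\partial F_N\times\partial F_N)\smallsetminus\Delta$ with $\Delta$ the diagonal, and $L^2(T)=\{(X,X')\in\partial^2F_N \mid \mathcal Q(X)=\mathcal Q(X')\}$. When $L^2(T_0)=L^2(T_1)$, a homeomorphism $f$ as in the claim exists (and is unique by surjectivity of $\mathcal Q_0$). *)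

theory Defs
  imports "HOL-Analysis.Abstract_Metric_Spaces" "HOL-Algebra.Group_Action"
    "HOL-Algebra.Generated_Groups"
begin

section \<open>The free group of rank N and its Gromov boundary\<close>

text \<open>The letter \<open>(i, True)\<close> is the \<open>i\<close>-th basis element and \<open>(i, False)\<close> its inverse. Elements of
  the free group are the reduced words; the Gromov boundary is the set of infinite reduced words,
  i.e. of the geodesic rays from the identity in the Cayley tree.\<close>

type_synonym letter = "nat \<times> bool"

definition inv_letter :: "letter \<Rightarrow> letter" where
  "inv_letter a = (fst a, \<not> snd a)"

definition reduced_word :: "letter list \<Rightarrow> bool" where
  "reduced_word w \<longleftrightarrow> successively (\<lambda>a b. b \<noteq> inv_letter a) w"

fun push_letter :: "letter \<Rightarrow> letter list \<Rightarrow> letter list" where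
  "push_letter a [] = [a]"
| "push_letter a (b # w) = (if b = inv_letter a then w else a # b # w)"

definition word_mult :: "letter list \<Rightarrow> letter list \<Rightarrow> letter list" where
  "word_mult u v = foldr push_letter u v"

definition free_group :: "nat \<Rightarrow> letter list monoid" where
  "free_group N =
    \<lparr>carrier = {w. reduced_word w \<and> (\<forall>a\<in>set w. fst a < N)}, mult = word_mult, one = []\<rparr>"

lemma inv_letter_inv_letter [simp]: "inv_letter (inv_letter a) = a"
  by (simp add: inv_letter_def)

lemma fst_inv_letter [simp]: "fst (inv_letter a) = fst a"
  by (simp add: inv_letter_def)

lemma inv_letter_neq [simp]: "inv_letter a \<noteq> a" "a \<noteq> inv_letter a"
  by (simp_all add: inv_letter_def prod_eq_iff)

lemma inv_letter_eq_iff: "inv_letter a = b \<longleftrightarrow> a = inv_letter b"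
  by auto

lemma reduced_word_simps [simp]:
  "reduced_word []" "reduced_word [a]"
  "reduced_word (a # b # w) \<longleftrightarrow> b \<noteq> inv_letter a \<and> reduced_word (b # w)"
  by (simp_all add: reduced_word_def)

lemma reduced_word_ConsD: "reduced_word (a # w) \<Longrightarrow> reduced_word w"
  by (cases w) auto

lemma reduced_word_push: "reduced_word w \<Longrightarrow> reduced_word (push_letter a w)"
  by (cases w) (auto dest: reduced_word_ConsD)

lemma set_push_letter: "set (push_letter a w) \<subseteq> insert a (set w)"
  by (cases w) auto

lemma push_inv_letter: "reduced_word w \<Longrightarrow> push_letter a (push_letter (inv_letter a) w) = w"
proof (cases w)
  case (Cons b v)
  then show "reduced_word w \<Longrightarrow> ?thesis" by (cases v) auto
qed auto

lemma reduced_word_mult: "reduced_word v \<Longrightarrow> reduced_word (word_mult u v)"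
  by (induction u) (auto simp: word_mult_def reduced_word_push)

lemma set_word_mult: "set (word_mult u v) \<subseteq> set u \<union> set v"
proof (induction u)
  case (Cons a u)
  then show ?case
    using set_push_letter[of a "word_mult u v"] by (auto simp: word_mult_def)
qed (simp add: word_mult_def)

lemma word_mult_push:
  "reduced_word w \<Longrightarrow> word_mult (push_letter a u) w = push_letter a (word_mult u w)"
proof (cases u)
  case (Cons b v)
  assume "reduced_word w"
  then have "push_letter (inv_letter b) (push_letter b (word_mult v w)) = word_mult v w"
    using push_inv_letter[of "word_mult v w" "inv_letter b"] reduced_word_mult by auto
  then show ?thesis using Cons by (auto simp: word_mult_def)
qed (simp add: word_mult_def)

lemma word_mult_assoc:
  "reduced_word w \<Longrightarrow> word_mult (word_mult u v) w = word_mult u (word_mult v w)"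
proof (induction u)
  case (Cons a u)
  have "word_mult (a # u) v = push_letter a (word_mult u v)" for v
    by (simp add: word_mult_def)
  with Cons show ?case by (simp add: word_mult_push)
qed (simp add: word_mult_def)

lemma word_mult_Nil_right: "reduced_word u \<Longrightarrow> word_mult u [] = u"
proof (induction u)
  case (Cons a u)
  then show ?case
    using reduced_word_ConsD[OF Cons.prems] by (cases u) (auto simp: word_mult_def)
qed (simp add: word_mult_def)

lemma reduced_word_rev_inv: "reduced_word u \<Longrightarrow> reduced_word (rev (map inv_letter u))"
  by (auto simp: reduced_word_def successively_map successively_rev inv_letter_eq_iff
      elim!: successively_mono)

lemma word_mult_left_inv: "word_mult (rev (map inv_letter u)) u = []"
proof (induction u)
  case (Cons a u)
  then show ?case by (simp add: word_mult_def)
qed (simp add: word_mult_def)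

lemma group_free_group: "group (free_group N)"
proof (rule groupI)
  fix x assume x: "x \<in> carrier (free_group N)"
  then have "rev (map inv_letter x) \<in> carrier (free_group N)"
    by (auto simp: free_group_def reduced_word_rev_inv)
  then show "\<exists>y\<in>carrier (free_group N). y \<otimes>\<^bsub>free_group N\<^esub> x = \<one>\<^bsub>free_group N\<^esub>"
    using word_mult_left_inv[of x]
    by (intro bexI[of _ "rev (map inv_letter x)"]) (simp_all add: free_group_def)
next
  fix x y assume "x \<in> carrier (free_group N)" "y \<in> carrier (free_group N)"
  then show "x \<otimes>\<^bsub>free_group N\<^esub> y \<in> carrier (free_group N)"
    using set_word_mult[of x y] by (auto simp: free_group_def reduced_word_mult)
qed (simp_all add: free_group_def word_mult_assoc, simp_all add: word_mult_def)

definition free_group_boundary :: "nat \<Rightarrow> (nat \<Rightarrow> letter) set" where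
  "free_group_boundary N = {X. \<forall>n. fst (X n) < N \<and> X (Suc n) \<noteq> inv_letter (X n)}"

definition converges_to_boundary :: "(nat \<Rightarrow> letter list) \<Rightarrow> (nat \<Rightarrow> letter) \<Rightarrow> bool" where
  "converges_to_boundary w X \<longleftrightarrow> (\<forall>k. \<forall>\<^sub>F i in sequentially. take k (w i) = map X [0..<k])"

section \<open>R-trees\<close>

definition isometric_path ::
    "'a set \<Rightarrow> ('a \<Rightarrow> 'a \<Rightarrow> real) \<Rightarrow> real set \<Rightarrow> (real \<Rightarrow> 'a) \<Rightarrow> bool" where
  "isometric_path M d I \<gamma> \<longleftrightarrow> \<gamma> ` I \<subseteq> M \<and> (\<forall>s\<in>I. \<forall>t\<in>I. d (\<gamma> s) (\<gamma> t) = \<bar>s - t\<bar>)"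

definition geodesic_from_to ::
    "'a set \<Rightarrow> ('a \<Rightarrow> 'a \<Rightarrow> real) \<Rightarrow> 'a \<Rightarrow> 'a \<Rightarrow> (real \<Rightarrow> 'a) \<Rightarrow> bool" where
  "geodesic_from_to M d x y \<gamma> \<longleftrightarrow>
    isometric_path M d {0..d x y} \<gamma> \<and> \<gamma> 0 = x \<and> \<gamma> (d x y) = y"

definition gromov_product :: "('a \<Rightarrow> 'a \<Rightarrow> real) \<Rightarrow> 'a \<Rightarrow> 'a \<Rightarrow> 'a \<Rightarrow> real" where
  "gromov_product d w x y = (d w x + d w y - d x y) / 2"

definition R_tree :: "'a set \<Rightarrow> ('a \<Rightarrow> 'a \<Rightarrow> real) \<Rightarrow> bool" where
  "R_tree T d \<longleftrightarrow> Metric_space T d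
    \<and> (\<forall>w\<in>T. \<forall>x\<in>T. \<forall>y\<in>T. \<forall>z\<in>T.
         min (gromov_product d w x y) (gromov_product d w y z) \<le> gromov_product d w x z)
    \<and> (\<forall>x\<in>T. \<forall>y\<in>T. \<exists>\<gamma>. geodesic_from_to T d x y \<gamma>)"

text \<open>The union of all geodesics from \<open>x\<close> to \<open>y\<close>; in an R-tree there is only one.\<close>

definition arc :: "'a set \<Rightarrow> ('a \<Rightarrow> 'a \<Rightarrow> real) \<Rightarrow> 'a \<Rightarrow> 'a \<Rightarrow> 'a set" where
  "arc M d x y = {\<gamma> t | \<gamma> t. geodesic_from_to M d x y \<gamma> \<and> 0 \<le> t \<and> t \<le> d x y}"

section \<open>Metric completion, Gromov boundary, and their union\<close>

definition cauchy_rel ::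
    "'a set \<Rightarrow> ('a \<Rightarrow> 'a \<Rightarrow> real) \<Rightarrow> ((nat \<Rightarrow> 'a) \<times> (nat \<Rightarrow> 'a)) set" where
  "cauchy_rel T d = {(s, t). Metric_space.MCauchy T d s \<and> Metric_space.MCauchy T d t
    \<and> (\<lambda>n. d (s n) (t n)) \<longlonglongrightarrow> 0}"

definition completion :: "'a set \<Rightarrow> ('a \<Rightarrow> 'a \<Rightarrow> real) \<Rightarrow> (nat \<Rightarrow> 'a) set set" where
  "completion T d = {s. Metric_space.MCauchy T d s} // cauchy_rel T d"

text \<open>The value 0 outside the carrier is needed because \<^locale>\<open>Metric_space\<close> requires a
  nonnegative symmetric function on the whole type.\<close>

definition completion_dist ::
    "'a set \<Rightarrow> ('a \<Rightarrow> 'a \<Rightarrow> real) \<Rightarrow> (nat \<Rightarrow> 'a) set \<Rightarrow> (nat \<Rightarrow> 'a) set \<Rightarrow> real" where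
  "completion_dist T d A B =
    (if A \<in> completion T d \<and> B \<in> completion T d
     then THE r. \<forall>s\<in>A. \<forall>t\<in>B. (\<lambda>n. d (s n) (t n)) \<longlonglongrightarrow> r else 0)"

definition embed :: "'a set \<Rightarrow> ('a \<Rightarrow> 'a \<Rightarrow> real) \<Rightarrow> 'a \<Rightarrow> (nat \<Rightarrow> 'a) set" where
  "embed T d x = cauchy_rel T d `` {\<lambda>_. x}"

abbreviation completion_topology ::
    "'a set \<Rightarrow> ('a \<Rightarrow> 'a \<Rightarrow> real) \<Rightarrow> (nat \<Rightarrow> 'a) set topology" where
  "completion_topology T d \<equiv> Metric_space.mtopology (completion T d) (completion_dist T d)"

text \<open>Two sets "differ only in a compact subset" when their symmetric difference lies in a compact
  set (the symmetric difference itself may be a half-open segment).\<close>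

definition differ_compactly :: "'a topology \<Rightarrow> 'a set \<Rightarrow> 'a set \<Rightarrow> bool" where
  "differ_compactly X A B \<longleftrightarrow> (\<exists>K. compactin X K \<and> (A - B) \<union> (B - A) \<subseteq> K)"

text \<open>A ray is a function on all of \<^typ>\<open>real\<close> whose values at negative arguments are irrelevant;
  each equivalence class contains all choices of these values.\<close>

definition rays :: "'a set \<Rightarrow> ('a \<Rightarrow> 'a \<Rightarrow> real) \<Rightarrow> (real \<Rightarrow> 'a) set" where
  "rays T d = {\<rho>. isometric_path T d {0..} \<rho>}"

definition ray_rel ::
    "'a set \<Rightarrow> ('a \<Rightarrow> 'a \<Rightarrow> real) \<Rightarrow> ((real \<Rightarrow> 'a) \<times> (real \<Rightarrow> 'a)) set" where
  "ray_rel T d = {(\<rho>, \<sigma>). \<rho> \<in> rays T d \<and> \<sigma> \<in> rays T d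
    \<and> differ_compactly (Metric_space.mtopology T d) (\<rho> ` {0..}) (\<sigma> ` {0..})}"

definition tree_boundary :: "'a set \<Rightarrow> ('a \<Rightarrow> 'a \<Rightarrow> real) \<Rightarrow> (real \<Rightarrow> 'a) set set" where
  "tree_boundary T d = rays T d // ray_rel T d"

datatype 'a hat_point = Pt "(nat \<Rightarrow> 'a) set" | End "(real \<Rightarrow> 'a) set"

definition hat :: "'a set \<Rightarrow> ('a \<Rightarrow> 'a \<Rightarrow> real) \<Rightarrow> 'a hat_point set" where
  "hat T d = Pt ` completion T d \<union> End ` tree_boundary T d"

fun hat_dist ::
    "'a set \<Rightarrow> ('a \<Rightarrow> 'a \<Rightarrow> real) \<Rightarrow> 'a hat_point \<Rightarrow> 'a hat_point \<Rightarrow> real" where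
  "hat_dist T d (Pt A) (Pt B) = completion_dist T d A B"
| "hat_dist T d _ _ = 0"

text \<open>The part of \<open>\<gamma>\<close> on \<open>{0..}\<close> is a geodesic ray of the completion tending to the end \<open>\<xi>\<close>.
  (A ray starting at a point of the completion outside \<open>T\<close> is not a ray of \<open>T\<close>.)\<close>

definition ray_to_end ::
    "'a set \<Rightarrow> ('a \<Rightarrow> 'a \<Rightarrow> real) \<Rightarrow> (real \<Rightarrow> (nat \<Rightarrow> 'a) set) \<Rightarrow> (real \<Rightarrow> 'a) set \<Rightarrow> bool" where
  "ray_to_end T d \<gamma> \<xi> \<longleftrightarrow> isometric_path (completion T d) (completion_dist T d) {0..} \<gamma>
    \<and> (\<forall>\<rho>\<in>\<xi>. differ_compactly (completion_topology T d) (\<gamma> ` {0..}) (embed T d ` \<rho> ` {0..}))"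

fun seg ::
    "'a set \<Rightarrow> ('a \<Rightarrow> 'a \<Rightarrow> real) \<Rightarrow> 'a hat_point \<Rightarrow> 'a hat_point \<Rightarrow> 'a hat_point set" where
  "seg T d (Pt A) (Pt B) = Pt ` arc (completion T d) (completion_dist T d) A B"
| "seg T d (Pt A) (End \<xi>) =
    {Pt (\<gamma> t) | \<gamma> t. ray_to_end T d \<gamma> \<xi> \<and> \<gamma> 0 = A \<and> 0 \<le> t} \<union> {End \<xi>}"
| "seg T d (End \<xi>) (Pt A) =
    {Pt (\<gamma> t) | \<gamma> t. ray_to_end T d \<gamma> \<xi> \<and> \<gamma> 0 = A \<and> 0 \<le> t} \<union> {End \<xi>}"
| "seg T d (End \<xi>) (End \<eta>) =
    {Pt (\<gamma> t) | \<gamma> t. isometric_path (completion T d) (completion_dist T d) UNIV \<gamma>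
      \<and> ray_to_end T d \<gamma> \<eta> \<and> ray_to_end T d (\<lambda>s. \<gamma> (- s)) \<xi>} \<union> {End \<xi>, End \<eta>}"

definition direction ::
    "'a set \<Rightarrow> ('a \<Rightarrow> 'a \<Rightarrow> real) \<Rightarrow> 'a hat_point \<Rightarrow> 'a hat_point \<Rightarrow> 'a hat_point set" where
  "direction T d P Q = {R \<in> hat T d. R \<noteq> P \<and> P \<notin> seg T d Q R}"

definition observers_topology :: "'a set \<Rightarrow> ('a \<Rightarrow> 'a \<Rightarrow> real) \<Rightarrow> 'a hat_point topology" where
  "observers_topology T d = topology_generated_by
    (insert (hat T d) {direction T d P Q | P Q. P \<in> hat T d \<and> Q \<in> hat T d \<and> P \<noteq> Q})"

text \<open>Basic neighbourhoods of an end: the directions at points of \<open>T\<close> whose intersection with the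
  rays of the end is not relatively compact. (Mere non-compactness would also admit the direction
  pointing back along a ray, which meets it in a half-open segment.)\<close>

definition end_neighbourhoods ::
    "'a set \<Rightarrow> ('a \<Rightarrow> 'a \<Rightarrow> real) \<Rightarrow> (real \<Rightarrow> 'a) set \<Rightarrow> 'a hat_point set set" where
  "end_neighbourhoods T d \<xi> =
    {direction T d P Q | P Q. P \<in> Pt ` embed T d ` T \<and> Q \<in> hat T d \<and> P \<noteq> Q
      \<and> (\<forall>\<rho>\<in>\<xi>. \<not> (\<exists>K. compactin (Metric_space.mtopology T d) K
            \<and> {x \<in> \<rho> ` {0..}. Pt (embed T d x) \<in> direction T d P Q} \<subseteq> K))}"

definition hat_metric_topology :: "'a set \<Rightarrow> ('a \<Rightarrow> 'a \<Rightarrow> real) \<Rightarrow> 'a hat_point topology" where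
  "hat_metric_topology T d = topology_generated_by
    ({Pt ` U | U. openin (completion_topology T d) U}
      \<union> (\<Union>\<xi>\<in>tree_boundary T d. end_neighbourhoods T d \<xi>))"

definition extremal :: "'a set \<Rightarrow> ('a \<Rightarrow> 'a \<Rightarrow> real) \<Rightarrow> 'a hat_point \<Rightarrow> bool" where
  "extremal T d P \<longleftrightarrow>
    connectedin (Metric_space.mtopology T d) {x \<in> T. Pt (embed T d x) \<noteq> P}"

definition interior_tree :: "'a set \<Rightarrow> ('a \<Rightarrow> 'a \<Rightarrow> real) \<Rightarrow> 'a hat_point set" where
  "interior_tree T d = {P \<in> Pt ` embed T d ` T. \<not> extremal T d P}"

section \<open>Actions\<close>

definition isometric_action ::
    "('g, 'm) monoid_scheme \<Rightarrow> 'a set \<Rightarrow> ('a \<Rightarrow> 'a \<Rightarrow> real) \<Rightarrow> ('g \<Rightarrow> 'a \<Rightarrow> 'a) \<Rightarrow> bool" where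
  "isometric_action G T d \<phi> \<longleftrightarrow> group_action G T \<phi>
    \<and> (\<forall>g\<in>carrier G. \<forall>x\<in>T. \<forall>y\<in>T. d (\<phi> g x) (\<phi> g y) = d x y)"

definition pointwise_stabilizer ::
    "('g, 'm) monoid_scheme \<Rightarrow> ('g \<Rightarrow> 'a \<Rightarrow> 'a) \<Rightarrow> 'a set \<Rightarrow> 'g set" where
  "pointwise_stabilizer G \<phi> A = {g \<in> carrier G. \<forall>x\<in>A. \<phi> g x = x}"

definition maximal_cyclic :: "('g, 'm) monoid_scheme \<Rightarrow> 'g set \<Rightarrow> bool" where
  "maximal_cyclic G H \<longleftrightarrow> (\<exists>a\<in>carrier G. H = generate G {a})
    \<and> (\<forall>b\<in>carrier G. H \<subseteq> generate G {b} \<longrightarrow> generate G {b} = H)"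

definition very_small ::
    "('g, 'm) monoid_scheme \<Rightarrow> 'a set \<Rightarrow> ('a \<Rightarrow> 'a \<Rightarrow> real) \<Rightarrow> ('g \<Rightarrow> 'a \<Rightarrow> 'a) \<Rightarrow> bool" where
  "very_small G T d \<phi> \<longleftrightarrow>
    (\<forall>x\<in>T. \<forall>y\<in>T. x \<noteq> y \<longrightarrow>
      pointwise_stabilizer G \<phi> (arc T d x y) = {\<one>\<^bsub>G\<^esub>} \<or>
      maximal_cyclic G (pointwise_stabilizer G \<phi> (arc T d x y)))
    \<and> (\<forall>x\<in>T. \<forall>y\<in>T. \<forall>z\<in>T. x \<notin> arc T d y z \<and> y \<notin> arc T d z x \<and> z \<notin> arc T d x y \<longrightarrow>
      pointwise_stabilizer G \<phi> (arc T d x y \<union> arc T d y z \<union> arc T d z x) = {\<one>\<^bsub>G\<^esub>})"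

definition dense_orbits ::
    "('g, 'm) monoid_scheme \<Rightarrow> 'a set \<Rightarrow> ('a \<Rightarrow> 'a \<Rightarrow> real) \<Rightarrow> ('g \<Rightarrow> 'a \<Rightarrow> 'a) \<Rightarrow> bool" where
  "dense_orbits G T d \<phi> \<longleftrightarrow>
    (\<exists>x\<in>T. Metric_space.mtopology T d closure_of (orbit G \<phi> x) = T)"

fun hat_action ::
    "'a set \<Rightarrow> ('a \<Rightarrow> 'a \<Rightarrow> real) \<Rightarrow> ('g \<Rightarrow> 'a \<Rightarrow> 'a) \<Rightarrow> 'g \<Rightarrow> 'a hat_point \<Rightarrow> 'a hat_point" where
  "hat_action T d \<phi> g (Pt A) = Pt (cauchy_rel T d `` ((\<lambda>s. \<phi> g \<circ> s) ` A))"
| "hat_action T d \<phi> g (End \<xi>) = End (ray_rel T d `` ((\<lambda>\<rho>. \<phi> g \<circ> \<rho>) ` \<xi>))"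

section \<open>The map Q and the dual lamination\<close>

definition hat_liminf ::
    "'a set \<Rightarrow> ('a \<Rightarrow> 'a \<Rightarrow> real) \<Rightarrow> 'a hat_point \<Rightarrow> (nat \<Rightarrow> 'a hat_point) \<Rightarrow> 'a hat_point" where
  "hat_liminf T d Q P = (THE L. \<exists>R. (\<forall>m. R m \<in> hat T d)
    \<and> (\<forall>m. (\<Inter>n\<in>{m..}. seg T d Q (P n)) = seg T d Q (R m))
    \<and> limitin (hat_metric_topology T d) R L sequentially)"

definition Qmap ::
    "nat \<Rightarrow> 'a set \<Rightarrow> ('a \<Rightarrow> 'a \<Rightarrow> real) \<Rightarrow> (letter list \<Rightarrow> 'a \<Rightarrow> 'a) \<Rightarrow> (nat \<Rightarrow> letter)
      \<Rightarrow> 'a hat_point" where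
  "Qmap N T d \<phi> X = (THE L. \<forall>w. \<forall>x\<in>T.
    range w \<subseteq> carrier (free_group N) \<and> converges_to_boundary w X \<longrightarrow>
    hat_liminf T d (Pt (embed T d x)) (\<lambda>i. Pt (embed T d (\<phi> (w i) x))) = L)"

definition dual_lamination ::
    "nat \<Rightarrow> 'a set \<Rightarrow> ('a \<Rightarrow> 'a \<Rightarrow> real) \<Rightarrow> (letter list \<Rightarrow> 'a \<Rightarrow> 'a)
      \<Rightarrow> ((nat \<Rightarrow> letter) \<times> (nat \<Rightarrow> letter)) set" where
  "dual_lamination N T d \<phi> = {(X, X'). X \<in> free_group_boundary N \<and> X' \<in> free_group_boundary N
    \<and> X \<noteq> X' \<and> Qmap N T d \<phi> X = Qmap N T d \<phi> X'}"

end

(* An end does not separate the observers' topology, whereas a point A of the completion does, and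
   Q and R lie in different directions at A exactly when no connected subset avoiding A contains both.
   Hence f maps interior points to points of the completion and preserves betweenness, so medians are
   the same for all the metrics d_lambda and d_lambda is additive along arcs. On an arc, the distance
   d_1 is a monotone surjective, hence continuous, function of the distance d_0, so that arcs stay
   geodesic for d_lambda. Since a Gromov product is the distance from the base point to a median,
   0-hyperbolicity only depends on the order of two medians on an arc. *)

theory Submission
  imports Defs
begin

section \<open>Trees as geodesic four-point metrics\<close>

text \<open>What does transfer is connectedness. The completion maps continuously into the
  observers' topology, so arcs remain connected there, and a point missed by the image or preimage
  of an arc cannot separate the points that this connected set joins. Taking preimages under
  \<open>f\<close> shows that arcs map into arcs, which makes \<open>d_1\<close> monotone along an
  arc; taking images shows that no point of the target arc is missed, which is the surjectivity.

  An interior point is only shown to land in the completion of \<open>T_1\<close>, and connected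
  sets of the observers' topology may contain ends. Hence the completion itself has to be a tree,
  and separation at a point has to be understood for ends too. An end does not separate because the
  points of the completion are connected and dense.\<close>

definition between :: "('a \<Rightarrow> 'a \<Rightarrow> real) \<Rightarrow> 'a \<Rightarrow> 'a \<Rightarrow> 'a \<Rightarrow> bool" where
  "between d x y z \<longleftrightarrow> d x y + d y z = d x z"

text \<open>Doubling all terms and subtracting them from \<open>d w x + d w y + d w z\<close> turns
  the minimum of Gromov products into a maximum of sums in which no base point is
  distinguished.\<close>

lemma (in Metric_space) gromov_inequality_iff:
  "min (gromov_product d w x y) (gromov_product d w y z) \<le> gromov_product d w x z \<longleftrightarrow>
    d x z + d w y \<le> max (d x w + d z y) (d x y + d z w)"
  using commute[of w x] commute[of w z] commute[of z y]
  by (auto simp: gromov_product_def max_def min_def field_simps)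

text \<open>Geodesics are replaced by single points at prescribed distances. Such points are easier
  to produce, in the completion and for the combined metric, and the four-point condition assembles
  them into a path.\<close>

locale tree_metric = Metric_space M d for M :: "'a set" and d :: "'a \<Rightarrow> 'a \<Rightarrow> real" +
  assumes four_point: "\<lbrakk>x \<in> M; y \<in> M; z \<in> M; w \<in> M\<rbrakk> \<Longrightarrow>
      d x y + d z w \<le> max (d x z + d y w) (d x w + d y z)"
    and interpolation: "\<lbrakk>x \<in> M; y \<in> M; 0 \<le> t; t \<le> d x y\<rbrakk> \<Longrightarrow>
      \<exists>z\<in>M. d x z = t \<and> d z y = d x y - t"
begin

lemma between_commute: "between d x y z \<longleftrightarrow> between d z y x"
  by (metis add.commute between_def commute)

lemma between_self_iff:
  "\<lbrakk>x \<in> M; a \<in> M\<rbrakk> \<Longrightarrow> between d x a x \<longleftrightarrow> x = a"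
  using commute[of a x] nonneg[of x a] zero[of x a] by (auto simp: between_def)

text \<open>Cancelling \<open>d a z\<close> or \<open>d x a\<close> in the four-point inequality
  leaves the reverse of a triangle inequality. Geometrically, no \<open>y\<close> is on the same
  side of \<open>a\<close> as both \<open>x\<close> and \<open>z\<close>; this is what makes
  directions disjoint or equal.\<close>

lemma between_split:
  assumes "between d x a z" "x \<in> M" "a \<in> M" "z \<in> M" "y \<in> M"
  shows "between d x a y \<or> between d y a z"
  using assms four_point[of x z y a] triangle[of x a y] triangle[of y a z]
    commute[of y a] commute[of z a] commute[of y z]
  by (auto simp: between_def max_def split: if_splits)

text \<open>Of the two alternatives of the four-point inequality, one would force
  \<open>d a b \<le> 0\<close>. The overlap \<open>[a, b]\<close> must therefore be nondegenerate
  for two arcs to concatenate without backtracking.\<close>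

lemma between_extend:
  assumes "between d x a b" "between d a b c" "a \<noteq> b" "x \<in> M" "a \<in> M" "b \<in> M" "c \<in> M"
  shows "between d x a c"
proof -
  have "d a b > 0" using assms nonneg[of a b] zero[of a b] by linarith
  then show ?thesis
    using assms(1,2) four_point[of x b a c] triangle[of x a c] commute[of a b] assms(4-)
    unfolding between_def by linarith
qed

lemma between_trans:
  assumes "between d x a b" "between d x b c" "x \<in> M" "a \<in> M" "b \<in> M" "c \<in> M"
  shows "between d x a c" "between d a b c"
  using assms triangle[of x a c] triangle[of a b c] by (auto simp: between_def)

text \<open>Two points of one arc are compared by the four-point inequality for them and the
  endpoints. This is the reason why arcs are unique and isometric to intervals.\<close>

lemma between_dist:
  assumes "between d x a y" "between d x b y" "x \<in> M" "a \<in> M" "b \<in> M" "y \<in> M"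
  shows "d a b = \<bar>d x a - d x b\<bar>"
proof -
  have "d x y + d a b \<le> max (d x a + d b y) (d x b + d a y)"
    using four_point[of x y a b] assms commute[of y a] commute[of y b] by metis
  moreover have "d x a \<le> d x b + d a b" "d x b \<le> d x a + d a b"
    using triangle[of x a b] triangle[of x b a] assms commute[of a b] by metis+
  ultimately show ?thesis
    using assms(1,2) unfolding between_def by linarith
qed

lemma between_unique:
  assumes "between d x a y" "between d x b y" "d x a = d x b" "x \<in> M" "a \<in> M" "b \<in> M" "y \<in> M"
  shows "a = b"
  using between_dist[of x a y b] assms zero[of a b] by simp

lemma between_linear:
  assumes "between d x a y" "between d x b y" "d x a \<le> d x b" "x \<in> M" "a \<in> M" "b \<in> M" "y \<in> M"
  shows "between d x a b"
  using between_dist[of x a y b] assms by (simp add: between_def)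

lemma median:
  assumes "w \<in> M" "x \<in> M" "y \<in> M"
  obtains m where "m \<in> M" "between d w m x" "between d w m y" "between d x m y"
proof -
  \<comment> \<open>The Gromov product of \<open>x\<close> and \<open>y\<close> at \<open>w\<close>,
    that is, the distance from \<open>w\<close> to the branch point of the tripod.\<close>
  define t where "t = (d w x + d w y - d x y) / 2"
  have "0 \<le> t" "t \<le> d w x"
    using triangle[of x w y] triangle[of w x y] commute[of x w] assms by (auto simp: t_def)
  then obtain m where m: "m \<in> M" "d w m = t" "d m x = d w x - t"
    using interpolation assms by blast
  have "d w x + d m y \<le> max (t + d x y) (d w y + (d w x - t))"
    using four_point[of w x m y] m assms commute[of x m] by simp
  then have "d m y \<le> d w y - t" "d m y \<le> d x y - (d w x - t)"
    by (auto simp: t_def max_def field_simps split: if_splits)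
  then have "between d w m x" "between d w m y" "between d x m y"
    using m triangle[of w m y] triangle[of x m y] commute[of x m] assms
    by (auto simp: between_def)
  then show thesis using that m by blast
qed

text \<open>The interpolating points may be chosen independently of each other, since
  \<open>between_dist\<close> makes any such choice isometric.\<close>

lemma exists_geodesic:
  assumes "x \<in> M" "y \<in> M"
  obtains \<gamma> where "geodesic_from_to M d x y \<gamma>"
proof -
  have "\<forall>t\<in>{0..d x y}. \<exists>z. z \<in> M \<and> d x z = t \<and> d z y = d x y - t"
    using interpolation assms by (metis atLeastAtMost_iff)
  then obtain \<gamma> where \<gamma>: "\<And>t. t \<in> {0..d x y} \<Longrightarrow> \<gamma> t \<in> M \<and> d x (\<gamma> t) = t \<and> d (\<gamma> t) y = d x y - t"
    by metis
  have btw: "between d x (\<gamma> t) y" if "t \<in> {0..d x y}" for t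
    using \<gamma>[OF that] by (simp add: between_def)
  have "d (\<gamma> s) (\<gamma> t) = \<bar>s - t\<bar>" if "s \<in> {0..d x y}" "t \<in> {0..d x y}" for s t
    using between_dist[OF btw btw, OF that] \<gamma>[OF that(1)] \<gamma>[OF that(2)] assms by simp
  moreover have "\<gamma> 0 = x"
  proof -
    have "\<gamma> 0 \<in> M" "d x (\<gamma> 0) = 0" using \<gamma>[of 0] by auto
    then show ?thesis using zero[of x "\<gamma> 0"] assms by blast
  qed
  moreover have "\<gamma> (d x y) = y"
  proof -
    have "\<gamma> (d x y) \<in> M" "d (\<gamma> (d x y)) y = 0" using \<gamma>[of "d x y"] by auto
    then show ?thesis using zero[of "\<gamma> (d x y)" y] assms by blast
  qed
  ultimately have "geodesic_from_to M d x y \<gamma>"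
    using \<gamma> unfolding geodesic_from_to_def isometric_path_def by blast
  then show thesis by (rule that)
qed

lemma geodesic_between:
  assumes "geodesic_from_to M d x y \<gamma>" "0 \<le> t" "t \<le> d x y"
  shows "\<gamma> t \<in> M" "d x (\<gamma> t) = t" "d (\<gamma> t) y = d x y - t" "between d x (\<gamma> t) y"
proof -
  have "0 \<in> {0..d x y}" "t \<in> {0..d x y}" "d x y \<in> {0..d x y}" using assms by auto
  then have "\<gamma> t \<in> M" "d (\<gamma> 0) (\<gamma> t) = \<bar>0 - t\<bar>" "d (\<gamma> t) (\<gamma> (d x y)) = \<bar>t - d x y\<bar>"
    using assms(1) unfolding geodesic_from_to_def isometric_path_def by blast+
  moreover have "\<gamma> 0 = x" "\<gamma> (d x y) = y"
    using assms(1) by (auto simp: geodesic_from_to_def)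
  ultimately show "\<gamma> t \<in> M" "d x (\<gamma> t) = t" "d (\<gamma> t) y = d x y - t" "between d x (\<gamma> t) y"
    using assms(2,3) by (auto simp: between_def)
qed

lemma arc_eq_between:
  assumes "x \<in> M" "y \<in> M"
  shows "arc M d x y = {z \<in> M. between d x z y}"
proof (intro equalityI subsetI)
  fix z assume "z \<in> arc M d x y"
  then show "z \<in> {z \<in> M. between d x z y}"
    using geodesic_between by (auto simp: arc_def)
next
  fix z assume z: "z \<in> {z \<in> M. between d x z y}"
  obtain \<gamma> where \<gamma>: "geodesic_from_to M d x y \<gamma>" using exists_geodesic assms by blast
  have le: "d x z \<le> d x y" using z nonneg[of z y] unfolding between_def mem_Collect_eq by linarith
  have "z = \<gamma> (d x z)"
    by (rule between_unique[of x z y]) (use z assms geodesic_between[OF \<gamma> nonneg le] in auto)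
  then show "z \<in> arc M d x y"
    using \<gamma> le nonneg[of x z] unfolding arc_def by blast
qed

lemma R_tree: "R_tree M d"
  unfolding R_tree_def
proof (intro conjI ballI)
  fix w x y z assume "w \<in> M" "x \<in> M" "y \<in> M" "z \<in> M"
  then show "min (gromov_product d w x y) (gromov_product d w y z) \<le> gromov_product d w x z"
    unfolding gromov_inequality_iff using four_point by blast
next
  fix x y assume "x \<in> M" "y \<in> M"
  then show "\<exists>\<gamma>. geodesic_from_to M d x y \<gamma>" by (rule exists_geodesic) blast
qed (rule Metric_space_axioms)

end

lemma tree_metric_iff_R_tree: "tree_metric M d \<longleftrightarrow> R_tree M d"
proof
  assume R: "R_tree M d"
  then interpret Metric_space M d by (simp add: R_tree_def)
  show "tree_metric M d"
  proof
    fix x y z w assume "x \<in> M" "y \<in> M" "z \<in> M" "w \<in> M"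
    then show "d x y + d z w \<le> max (d x z + d y w) (d x w + d y z)"
      unfolding gromov_inequality_iff[symmetric] using R unfolding R_tree_def by blast
  next
    fix x y t assume t: "x \<in> M" "y \<in> M" "0 \<le> t" "t \<le> d x y"
    then obtain \<gamma> where \<gamma>: "geodesic_from_to M d x y \<gamma>" using R unfolding R_tree_def by blast
    have I: "0 \<in> {0..d x y}" "t \<in> {0..d x y}" "d x y \<in> {0..d x y}" using t by auto
    then have "\<gamma> t \<in> M" "d (\<gamma> 0) (\<gamma> t) = \<bar>0 - t\<bar>" "d (\<gamma> t) (\<gamma> (d x y)) = \<bar>t - d x y\<bar>"
      using \<gamma> unfolding geodesic_from_to_def isometric_path_def by blast+
    then show "\<exists>z\<in>M. d x z = t \<and> d z y = d x y - t"
      using \<gamma> t by (intro bexI[of _ "\<gamma> t"]) (auto simp: geodesic_from_to_def)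
  qed
qed (simp add: tree_metric.R_tree)

section \<open>Topology of trees\<close>

lemma differ_compactly_sym: "differ_compactly X A B \<Longrightarrow> differ_compactly X B A"
  unfolding differ_compactly_def by (simp add: Un_commute)

lemma differ_compactly_trans:
  assumes "differ_compactly X A B" "differ_compactly X B C"
  shows "differ_compactly X A C"
proof -
  obtain K L where "compactin X K" "(A - B) \<union> (B - A) \<subseteq> K" "compactin X L" "(B - C) \<union> (C - B) \<subseteq> L"
    using assms unfolding differ_compactly_def by blast
  then have "compactin X (K \<union> L)" "(A - C) \<union> (C - A) \<subseteq> K \<union> L"
    by (auto simp: compactin_Un)
  then show ?thesis unfolding differ_compactly_def by blast
qed

lemma differ_compactly_common:
  "\<lbrakk>differ_compactly X A B; differ_compactly X C B\<rbrakk> \<Longrightarrow> differ_compactly X A C"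
  by (rule differ_compactly_trans[OF _ differ_compactly_sym])

lemma differ_compactly_refl: "differ_compactly X A A"
  unfolding differ_compactly_def by (rule exI[of _ "{}"]) simp

lemma differ_compactly_Un: "compactin X K \<Longrightarrow> differ_compactly X (K \<union> A) A"
  unfolding differ_compactly_def by blast

lemma differ_compactly_image:
  assumes "differ_compactly X A B" "continuous_map X Y f"
  shows "differ_compactly Y (f ` A) (f ` B)"
proof -
  obtain K where "compactin X K" "(A - B) \<union> (B - A) \<subseteq> K"
    using assms unfolding differ_compactly_def by blast
  then have "compactin Y (f ` K)" "(f ` A - f ` B) \<union> (f ` B - f ` A) \<subseteq> f ` K"
    using image_compactin assms(2) by blast+
  then show ?thesis unfolding differ_compactly_def by blast
qed

section \<open>Isometric paths in metric spaces\<close>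

lemma isometric_path_mono: "isometric_path M d I \<gamma> \<Longrightarrow> J \<subseteq> I \<Longrightarrow> isometric_path M d J \<gamma>"
  unfolding isometric_path_def by blast

lemma isometric_path_shift:
  "isometric_path M d I \<gamma> \<Longrightarrow> (\<lambda>t. a + t) ` J \<subseteq> I \<Longrightarrow> isometric_path M d J (\<lambda>t. \<gamma> (a + t))"
  unfolding isometric_path_def by (auto simp: image_subset_iff)

lemma isometric_path_neg:
  "isometric_path M d I \<gamma> \<Longrightarrow> uminus ` J \<subseteq> I \<Longrightarrow> isometric_path M d J (\<lambda>t. \<gamma> (- t))"
  unfolding isometric_path_def by (auto simp: image_subset_iff)

lemma isometric_pathD:
  assumes "isometric_path M d I \<gamma>" "s \<in> I"
  shows "\<gamma> s \<in> M" "t \<in> I \<Longrightarrow> d (\<gamma> s) (\<gamma> t) = \<bar>s - t\<bar>"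
  using assms unfolding isometric_path_def by blast+

lemma isometric_path_between:
  assumes "isometric_path M d I \<gamma>" "s \<in> I" "t \<in> I" "u \<in> I" "s \<le> t" "t \<le> u"
  shows "between d (\<gamma> s) (\<gamma> t) (\<gamma> u)" "between d (\<gamma> u) (\<gamma> t) (\<gamma> s)"
  using assms isometric_pathD(2)[OF assms(1)] by (simp_all add: between_def)

context Metric_space begin

lemma continuous_map_isometric_path:
  assumes "isometric_path M d I \<gamma>"
  shows "continuous_map (top_of_set I) mtopology \<gamma>"
  unfolding continuous_map_to_metric
proof (intro ballI allI impI)
  fix t and e :: real assume t: "t \<in> topspace (top_of_set I)" and e: "e > 0"
  have "d (\<gamma> t) (\<gamma> s) < e" if "s \<in> ball t e \<inter> I" for s
    using isometric_pathD(2)[OF assms, of t s] t that by (simp add: dist_real_def)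
  then have "\<forall>s\<in>ball t e \<inter> I. \<gamma> s \<in> mball (\<gamma> t) e"
    using isometric_pathD(1)[OF assms] t by simp
  moreover have "openin (top_of_set I) (ball t e \<inter> I)"
    by (simp add: Int_commute openin_open_Int)
  ultimately show "\<exists>U. openin (top_of_set I) U \<and> t \<in> U \<and> (\<forall>s\<in>U. \<gamma> s \<in> mball (\<gamma> t) e)"
    using t e by (intro exI[of _ "ball t e \<inter> I"]) simp
qed

lemma compactin_isometric_path:
  assumes "isometric_path M d I \<gamma>" "{a..b} \<subseteq> I"
  shows "compactin mtopology (\<gamma> ` {a..b})"
proof -
  have "isometric_path M d {a..b} \<gamma>" using assms isometric_path_mono by blast
  moreover have "compactin (top_of_set {a..b}) {a..b}"
    by (simp add: compactin_subtopology)
  ultimately show ?thesis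
    using image_compactin continuous_map_isometric_path by blast
qed

lemma connectedin_isometric_path:
  assumes "isometric_path M d {a..b} \<gamma>"
  shows "connectedin mtopology (\<gamma> ` {a..b})"
proof -
  have "connectedin (top_of_set {a..b}) {a..b}"
    by (simp add: connectedin_subtopology)
  then show ?thesis
    using connectedin_continuous_map_image continuous_map_isometric_path assms by blast
qed

text \<open>Compact sets are bounded, whereas \<open>\<gamma>\<close> leaves every ball around
  \<open>\<gamma> 0\<close>.\<close>

lemma differ_compactly_eventually:
  assumes \<gamma>: "isometric_path M d {0..} \<gamma>" and "differ_compactly mtopology (\<gamma> ` {0..}) B"
  shows "eventually (\<lambda>t. \<gamma> t \<in> B) at_top"
proof -
  obtain K where K: "compactin mtopology K" "(\<gamma> ` {0..} - B) \<union> (B - \<gamma> ` {0..}) \<subseteq> K"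
    using assms unfolding differ_compactly_def by blast
  have "\<gamma> 0 \<in> M" using isometric_pathD(1)[OF \<gamma>] by simp
  then have "mbounded (insert (\<gamma> 0) K)"
    using compactin_imp_mbounded[OF K(1)] mbounded_insert by blast
  then obtain c where c: "\<forall>x\<in>insert (\<gamma> 0) K. \<forall>y\<in>insert (\<gamma> 0) K. d x y \<le> c"
    unfolding mbounded_alt by blast
  have "\<gamma> t \<in> B" if t: "t > max 0 c" for t
  proof (rule ccontr)
    assume "\<gamma> t \<notin> B"
    then have "\<gamma> t \<in> K" using K(2) t by auto
    then have "d (\<gamma> 0) (\<gamma> t) \<le> c" using c by blast
    then show False using isometric_pathD(2)[OF \<gamma>, of 0 t] t by simp
  qed
  then show ?thesis by (meson eventually_at_top_dense)
qed

end

section \<open>Sides of a point, cut points, and gluing of rays\<close>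

context tree_metric begin

text \<open>If \<open>a\<close> separated \<open>x\<close> from \<open>y\<close>, then
  \<open>d x y \<ge> d x a\<close>; so the open ball of radius \<open>d x a\<close> around
  \<open>x\<close> stays on the side of \<open>x\<close>, by \<open>between_split\<close>.\<close>

lemma openin_between:
  assumes "p \<in> M" "a \<in> M"
  shows "openin mtopology {x \<in> M. x \<noteq> a \<and> \<not> between d p a x}"
    and "openin mtopology {x \<in> M. x \<noteq> a \<and> between d p a x}"
proof -
  have close: "y \<noteq> a \<and> \<not> between d x a y \<and> \<not> between d y a x"
    if "x \<in> M" "x \<noteq> a" "y \<in> mball x (d x a)" for x y
    using that nonneg[of a y] nonneg[of x y] commute[of x y] commute[of x a] commute[of a y]
    unfolding in_mball between_def by (smt (verit))
  have pos: "d x a > 0" if "x \<in> M" "x \<noteq> a" for x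
    using that nonneg[of x a] zero[of x a] assms(2) by linarith
  show "openin mtopology {x \<in> M. x \<noteq> a \<and> \<not> between d p a x}"
    unfolding openin_mtopology
  proof (intro conjI allI impI)
    fix x assume x: "x \<in> {x \<in> M. x \<noteq> a \<and> \<not> between d p a x}"
    have "y \<in> {x \<in> M. x \<noteq> a \<and> \<not> between d p a x}" if y: "y \<in> mball x (d x a)" for y
      using x y close[of x y] between_split[of p a y x] assms by auto
    then show "\<exists>r>0. mball x r \<subseteq> {x \<in> M. x \<noteq> a \<and> \<not> between d p a x}"
      using pos[of x] x by blast
  qed auto
  show "openin mtopology {x \<in> M. x \<noteq> a \<and> between d p a x}"
    unfolding openin_mtopology
  proof (intro conjI allI impI)
    fix x assume x: "x \<in> {x \<in> M. x \<noteq> a \<and> between d p a x}"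
    have "y \<in> {x \<in> M. x \<noteq> a \<and> between d p a x}" if y: "y \<in> mball x (d x a)" for y
      using x y close[of x y] between_split[of p a x y] assms by auto
    then show "\<exists>r>0. mball x r \<subseteq> {x \<in> M. x \<noteq> a \<and> between d p a x}"
      using pos[of x] x by blast
  qed auto
qed

lemma connectedin_arc:
  assumes "x \<in> M" "y \<in> M"
  shows "connectedin mtopology {z \<in> M. between d x z y}"
proof -
  obtain \<gamma> where \<gamma>: "geodesic_from_to M d x y \<gamma>" using exists_geodesic assms by blast
  have "arc M d x y = \<gamma> ` {0..d x y}"
  proof
    show "\<gamma> ` {0..d x y} \<subseteq> arc M d x y" using \<gamma> unfolding arc_def by fastforce
    show "arc M d x y \<subseteq> \<gamma> ` {0..d x y}"
    proof
      fix z assume "z \<in> arc M d x y"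
      then have z: "z \<in> M" "between d x z y" using arc_eq_between assms by auto
      have le: "d x z \<le> d x y" using z(2) nonneg[of z y] unfolding between_def by linarith
      have "z = \<gamma> (d x z)"
        by (rule between_unique[of x z y]) (use z assms geodesic_between[OF \<gamma> nonneg le] in auto)
      then show "z \<in> \<gamma> ` {0..d x y}" using le by simp
    qed
  qed
  moreover have "connectedin mtopology (\<gamma> ` {0..d x y})"
    using \<gamma> connectedin_isometric_path unfolding geodesic_from_to_def by blast
  ultimately show ?thesis using arc_eq_between assms by simp
qed

lemma connectedin_if_arcs:
  assumes "S \<subseteq> M" "\<And>x y z. \<lbrakk>x \<in> S; y \<in> S; z \<in> M; between d x z y\<rbrakk> \<Longrightarrow> z \<in> S"
  shows "connectedin mtopology S"
proof (cases "S = {}")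
  case False
  then obtain x where x: "x \<in> S" by blast
  have "connectedin mtopology (\<Union>y\<in>S. {z \<in> M. between d x z y})"
  proof (rule connectedin_Union)
    show "\<Inter> ((\<lambda>y. {z \<in> M. between d x z y}) ` S) \<noteq> {}"
    proof -
      have "x \<in> \<Inter> ((\<lambda>y. {z \<in> M. between d x z y}) ` S)"
        using x assms(1) by (auto simp: between_def)
      then show ?thesis by blast
    qed
  qed (use connectedin_arc x assms(1) in auto)
  moreover have "(\<Union>y\<in>S. {z \<in> M. between d x z y}) = S"
  proof
    have "y \<in> {z \<in> M. between d x z y}" if "y \<in> S" for y
      using x assms(1) that by (auto simp: between_def)
    then show "S \<subseteq> (\<Union>y\<in>S. {z \<in> M. between d x z y})" by blast
    show "(\<Union>y\<in>S. {z \<in> M. between d x z y}) \<subseteq> S" using assms(2) x by blast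
  qed
  ultimately show ?thesis by simp
qed auto

lemma connectedin_mspace: "connectedin mtopology M"
  by (rule connectedin_if_arcs) auto

text \<open>Turns extremality into a statement about betweenness. The two sides of \<open>a\<close>
  as seen from \<open>x\<close> are open and cover the complement; if no arc crosses
  \<open>a\<close>, the complement contains the arcs between its points.\<close>

lemma connectedin_minus_point_iff:
  assumes "a \<in> M"
  shows "connectedin mtopology (M - {a}) \<longleftrightarrow>
    \<not> (\<exists>x\<in>M. \<exists>y\<in>M. x \<noteq> a \<and> y \<noteq> a \<and> between d x a y)"
proof
  assume con: "connectedin mtopology (M - {a})"
  show "\<not> (\<exists>x\<in>M. \<exists>y\<in>M. x \<noteq> a \<and> y \<noteq> a \<and> between d x a y)"
  proof
    assume "\<exists>x\<in>M. \<exists>y\<in>M. x \<noteq> a \<and> y \<noteq> a \<and> between d x a y"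
    then obtain x y where xy: "x \<in> M" "y \<in> M" "x \<noteq> a" "y \<noteq> a" "between d x a y" by blast
    let ?U = "{z \<in> M. z \<noteq> a \<and> \<not> between d x a z}" and ?V = "{z \<in> M. z \<noteq> a \<and> between d x a z}"
    have "openin mtopology ?U" "openin mtopology ?V" using openin_between xy assms by auto
    moreover have "M - {a} \<subseteq> ?U \<union> ?V" "?U \<inter> ?V \<inter> (M - {a}) = {}" by auto
    moreover have "x \<in> ?U \<inter> (M - {a})" "y \<in> ?V \<inter> (M - {a})"
      using xy between_self_iff[of x a] assms by auto
    ultimately show False using con unfolding connectedin by blast
  qed
next
  assume "\<not> (\<exists>x\<in>M. \<exists>y\<in>M. x \<noteq> a \<and> y \<noteq> a \<and> between d x a y)"
  then show "connectedin mtopology (M - {a})"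
    by (intro connectedin_if_arcs) blast+
qed

text \<open>One point of the ray at positive parameter decides: \<open>between_trans\<close> treats
  earlier points, \<open>between_extend\<close> later ones.\<close>

lemma between_ray:
  assumes \<gamma>: "isometric_path M d {0..} \<gamma>" and "x \<in> M" "s > 0" "between d x (\<gamma> 0) (\<gamma> s)" "t \<ge> 0"
  shows "between d x (\<gamma> 0) (\<gamma> t)"
proof (cases "t \<le> s")
  case True
  then have "between d (\<gamma> 0) (\<gamma> t) (\<gamma> s)" using isometric_path_between(1)[OF \<gamma>] assms by simp
  then have "between d (\<gamma> s) (\<gamma> t) (\<gamma> 0)" by (simp add: between_commute)
  moreover have "between d (\<gamma> s) (\<gamma> 0) x" using assms by (simp add: between_commute)
  ultimately have "between d (\<gamma> t) (\<gamma> 0) x"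
    by (rule between_trans(2)) (use isometric_pathD(1)[OF \<gamma>] assms in auto)
  then show ?thesis by (simp add: between_commute)
next
  case False
  then have "between d (\<gamma> 0) (\<gamma> s) (\<gamma> t)" using isometric_path_between(1)[OF \<gamma>] assms by simp
  moreover have "\<gamma> 0 \<noteq> \<gamma> s"
  proof
    assume "\<gamma> 0 = \<gamma> s"
    then have "d (\<gamma> 0) (\<gamma> s) = 0" using isometric_pathD(2)[OF \<gamma>, of 0 0] by simp
    then show False using isometric_pathD(2)[OF \<gamma>, of 0 s] assms(3) by simp
  qed
  ultimately show ?thesis
    using between_extend[of x "\<gamma> 0" "\<gamma> s" "\<gamma> t"] isometric_pathD(1)[OF \<gamma>] assms False by simp
qed

text \<open>The arc from \<open>x\<close> to \<open>\<gamma> 0\<close> followed by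
  \<open>\<gamma>\<close> does not backtrack, by \<open>between_ray\<close>, and only the compact
  arc has been added, so the end is unchanged.\<close>

lemma prepend_ray:
  assumes \<gamma>: "isometric_path M d {0..} \<gamma>" and "x \<in> M" "s > 0" "between d x (\<gamma> 0) (\<gamma> s)"
  obtains \<gamma>' where "isometric_path M d {0..} \<gamma>'" "\<gamma>' 0 = x" "\<gamma>' (d x (\<gamma> 0)) = \<gamma> 0"
    "differ_compactly mtopology (\<gamma>' ` {0..}) (\<gamma> ` {0..})"
proof -
  define L where "L = d x (\<gamma> 0)"
  have M: "\<gamma> t \<in> M" if "t \<ge> 0" for t using isometric_pathD(1)[OF \<gamma>] that by simp
  obtain \<delta> where \<delta>: "geodesic_from_to M d x (\<gamma> 0) \<delta>" using exists_geodesic assms(2) M by blast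
  define \<gamma>' where "\<gamma>' = (\<lambda>t. if t \<le> L then \<delta> t else \<gamma> (t - L))"
  have L: "L \<ge> 0" by (simp add: L_def)
  have \<delta>iso: "isometric_path M d {0..L} \<delta>" "\<delta> 0 = x" "\<delta> L = \<gamma> 0"
    using \<delta> by (auto simp: geodesic_from_to_def L_def)
  have cross: "d (\<delta> s) (\<gamma> t) = L - s + t" if "0 \<le> s" "s \<le> L" "0 \<le> t" for s t
  proof -
    have s: "\<delta> s \<in> M" "between d x (\<delta> s) (\<gamma> 0)" "d (\<delta> s) (\<gamma> 0) = L - s"
      using geodesic_between[OF \<delta>, of s] that by (auto simp: L_def)
    have "between d x (\<gamma> 0) (\<gamma> t)" using between_ray assms that by blast
    then have "between d (\<delta> s) (\<gamma> 0) (\<gamma> t)"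
      using between_trans(2)[OF s(2)] s M that assms(2) by simp
    then show ?thesis using s(3) isometric_pathD(2)[OF \<gamma>, of 0 t] that by (simp add: between_def)
  qed
  have iso: "isometric_path M d {0..} \<gamma>'"
    unfolding isometric_path_def
  proof (intro conjI ballI)
    show "\<gamma>' ` {0..} \<subseteq> M"
      using M isometric_pathD(1)[OF \<delta>iso(1)] by (auto simp: \<gamma>'_def)
    fix s t :: real assume st: "s \<in> {0..}" "t \<in> {0..}"
    consider "s \<le> L" "t \<le> L" | "s \<le> L" "t > L" | "s > L" "t \<le> L" | "s > L" "t > L" by linarith
    then show "d (\<gamma>' s) (\<gamma>' t) = \<bar>s - t\<bar>"
    proof cases
      case 1 then show ?thesis using isometric_pathD(2)[OF \<delta>iso(1), of s t] st by (simp add: \<gamma>'_def)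
    next
      case 2 then show ?thesis using cross[of s "t - L"] st by (simp add: \<gamma>'_def)
    next
      case 3
      then show ?thesis using cross[of t "s - L"] st commute[of "\<gamma> (s - L)" "\<delta> t"] by (simp add: \<gamma>'_def)
    next
      case 4 then show ?thesis using isometric_pathD(2)[OF \<gamma>, of "s - L" "t - L"] by (simp add: \<gamma>'_def)
    qed
  qed
  have "\<gamma>' ` {0..} = \<gamma>' ` {0..L} \<union> \<gamma> ` {0..}"
  proof (intro equalityI subsetI)
    fix z assume "z \<in> \<gamma>' ` {0..}"
    then obtain t where t: "t \<ge> 0" "z = \<gamma>' t" by auto
    show "z \<in> \<gamma>' ` {0..L} \<union> \<gamma> ` {0..}"
    proof (cases "t \<le> L")
      case False then show ?thesis using t by (simp add: \<gamma>'_def)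
    qed (use t in auto)
  next
    fix z assume "z \<in> \<gamma>' ` {0..L} \<union> \<gamma> ` {0..}"
    moreover have "\<gamma> t = \<gamma>' (L + t)" if "t \<ge> 0" for t
      using that \<delta>iso(3) by (cases "t = 0") (auto simp: \<gamma>'_def)
    ultimately show "z \<in> \<gamma>' ` {0..}" using L by fastforce
  qed
  moreover have "compactin mtopology (\<gamma>' ` {0..L})" using compactin_isometric_path[OF iso] by simp
  ultimately have "differ_compactly mtopology (\<gamma>' ` {0..}) (\<gamma> ` {0..})"
    using differ_compactly_Un by metis
  moreover have "\<gamma>' 0 = x" "\<gamma>' (d x (\<gamma> 0)) = \<gamma> 0"
    using \<delta>iso L by (auto simp: \<gamma>'_def L_def)
  ultimately show thesis using that iso by blast
qed

text \<open>\<open>between_ray\<close> is applied once to each ray, which spreads the separation at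
  parameter 1 to all pairs of parameters.\<close>

lemma rays_to_line:
  assumes \<gamma>: "isometric_path M d {0..} \<gamma>" and \<delta>: "isometric_path M d {0..} \<delta>" and "\<gamma> 0 = \<delta> 0"
    and "between d (\<gamma> 1) (\<gamma> 0) (\<delta> 1)"
  shows "isometric_path M d UNIV (\<lambda>t. if t \<ge> 0 then \<delta> t else \<gamma> (- t))"
proof -
  have M: "\<gamma> t \<in> M" "\<delta> t \<in> M" if "t \<ge> 0" for t
    using isometric_pathD(1)[OF \<gamma>] isometric_pathD(1)[OF \<delta>] that by auto
  have cross: "d (\<gamma> s) (\<delta> t) = s + t" if "s \<ge> 0" "t \<ge> 0" for s t
  proof -
    have "between d (\<gamma> 1) (\<delta> 0) (\<delta> t)"
      using between_ray[OF \<delta>, of "\<gamma> 1" 1 t] M assms(3,4) that by simp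
    then have "between d (\<delta> t) (\<gamma> 0) (\<gamma> 1)" using assms(3) by (simp add: between_commute)
    then have "between d (\<delta> t) (\<gamma> 0) (\<gamma> s)"
      using between_ray[OF \<gamma>, of "\<delta> t" 1 s] M that by simp
    then show ?thesis
      using isometric_pathD(2)[OF \<gamma>, of 0 s] isometric_pathD(2)[OF \<delta>, of t 0] that assms(3)
        commute[of "\<gamma> s" "\<delta> t"]
      by (simp add: between_def)
  qed
  show ?thesis
    unfolding isometric_path_def
  proof (intro conjI ballI)
    fix s t :: real
    consider "s \<ge> 0" "t \<ge> 0" | "s \<ge> 0" "t < 0" | "s < 0" "t \<ge> 0" | "s < 0" "t < 0" by linarith
    then show "d (if s \<ge> 0 then \<delta> s else \<gamma> (- s)) (if t \<ge> 0 then \<delta> t else \<gamma> (- t)) = \<bar>s - t\<bar>"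
    proof cases
      case 1 then show ?thesis using isometric_pathD(2)[OF \<delta>] by simp
    next
      case 2
      then show ?thesis using cross[of "- t" s] commute[of "\<delta> s" "\<gamma> (- t)"] by simp
    next
      case 3 then show ?thesis using cross[of "- s" t] by simp
    next
      case 4 then show ?thesis using isometric_pathD(2)[OF \<gamma>, of "- s" "- t"] by simp
    qed
  qed (use M in auto)
qed

end

section \<open>The metric completion of a tree\<close>

context Metric_space begin

lemma dist_diff_le:
  assumes "x \<in> M" "y \<in> M" "x' \<in> M" "y' \<in> M"
  shows "\<bar>d x y - d x' y'\<bar> \<le> d x x' + d y y'"
proof -
  have "d x y \<le> d x x' + d x' y" "d x' y \<le> d x' y' + d y' y"
    "d x' y' \<le> d x' x + d x y'" "d x y' \<le> d x y + d y y'"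
    using triangle assms by blast+
  then show ?thesis using commute[of x x'] commute[of y y'] by linarith
qed

lemma MCauchy_in: "MCauchy s \<Longrightarrow> s n \<in> M"
  unfolding MCauchy_def by blast

lemma MCauchy_dist_convergent:
  assumes "MCauchy s" "MCauchy t"
  shows "convergent (\<lambda>n. d (s n) (t n))"
proof -
  have "Cauchy (\<lambda>n. d (s n) (t n))"
    unfolding Cauchy_iff
  proof (intro allI impI)
    fix e :: real assume "e > 0"
    then have "e / 2 > 0" by simp
    then obtain A B where A: "\<And>n n'. A \<le> n \<Longrightarrow> A \<le> n' \<Longrightarrow> d (s n) (s n') < e / 2"
      and B: "\<And>n n'. B \<le> n \<Longrightarrow> B \<le> n' \<Longrightarrow> d (t n) (t n') < e / 2"
      using assms unfolding MCauchy_def by meson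
    have "norm (d (s m) (t m) - d (s n) (t n)) < e" if "m \<ge> max A B" "n \<ge> max A B" for m n
    proof -
      have "d (s m) (s n) < e / 2" "d (t m) (t n) < e / 2" using A[of m n] B[of m n] that by auto
      then show ?thesis
        using dist_diff_le[of "s m" "t m" "s n" "t n"] MCauchy_in assms by fastforce
    qed
    then show "\<exists>N. \<forall>m\<ge>N. \<forall>n\<ge>N. norm (d (s m) (t m) - d (s n) (t n)) < e" by blast
  qed
  then show ?thesis by (rule Cauchy_convergent)
qed

lemma tendsto_dist_transfer:
  assumes "range s \<subseteq> M" "range t \<subseteq> M" "range s' \<subseteq> M" "range t' \<subseteq> M"
    and "(\<lambda>n. d (s n) (s' n)) \<longlonglongrightarrow> 0" "(\<lambda>n. d (t n) (t' n)) \<longlonglongrightarrow> 0"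
    and "(\<lambda>n. d (s n) (t n)) \<longlonglongrightarrow> r"
  shows "(\<lambda>n. d (s' n) (t' n)) \<longlonglongrightarrow> r"
proof -
  have lim: "(\<lambda>n. d (s n) (s' n) + d (t n) (t' n)) \<longlonglongrightarrow> 0"
    using tendsto_add[OF assms(5,6)] by simp
  have le: "\<bar>d (s n) (t n) - d (s' n) (t' n)\<bar> \<le> d (s n) (s' n) + d (t n) (t' n)" for n
    using dist_diff_le assms(1-4) by (simp add: image_subset_iff)
  have "(\<lambda>n. d (s n) (t n) - d (s' n) (t' n)) \<longlonglongrightarrow> 0"
    by (rule Lim_null_comparison[OF _ lim]) (simp add: le)
  from tendsto_diff[OF assms(7) this] show ?thesis by simp
qed

lemma cauchy_rel_iff:
  "(s, t) \<in> cauchy_rel M d \<longleftrightarrow> MCauchy s \<and> MCauchy t \<and> (\<lambda>n. d (s n) (t n)) \<longlonglongrightarrow> 0"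
  by (simp add: cauchy_rel_def)

lemma equiv_cauchy_rel: "equiv {s. MCauchy s} (cauchy_rel M d)"
proof (intro equivI refl_onI symI transI)
  show "cauchy_rel M d \<subseteq> {s. MCauchy s} \<times> {s. MCauchy s}" by (auto simp: cauchy_rel_iff)
next
  fix s assume "s \<in> {s. MCauchy s}"
  then show "(s, s) \<in> cauchy_rel M d" using MCauchy_in by (simp add: cauchy_rel_iff)
next
  fix s t assume "(s, t) \<in> cauchy_rel M d"
  then show "(t, s) \<in> cauchy_rel M d" by (simp add: cauchy_rel_iff commute)
next
  fix s t u assume st: "(s, t) \<in> cauchy_rel M d" and tu: "(t, u) \<in> cauchy_rel M d"
  have r: "range s \<subseteq> M" "range t \<subseteq> M" "range u \<subseteq> M"
    using st tu by (auto simp: cauchy_rel_iff MCauchy_def)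
  have "(\<lambda>n. d (s n) (s n)) \<longlonglongrightarrow> 0" using r by (simp add: image_subset_iff)
  then have "(\<lambda>n. d (s n) (u n)) \<longlonglongrightarrow> 0"
    using tendsto_dist_transfer[of s t s u 0] r st tu by (simp add: cauchy_rel_iff)
  then show "(s, u) \<in> cauchy_rel M d" using st tu by (simp add: cauchy_rel_iff)
qed

abbreviation C where "C \<equiv> completion M d"
abbreviation D where "D \<equiv> completion_dist M d"
abbreviation cls where "cls s \<equiv> cauchy_rel M d `` {s}"

lemma completion_cases:
  assumes "A \<in> C"
  obtains s where "MCauchy s" "A = cls s"
  using assms unfolding completion_def by (auto elim: quotientE)

lemma cls_in_completion: "MCauchy s \<Longrightarrow> cls s \<in> C"
  unfolding completion_def by (rule quotientI) simp

text \<open>Discharges the definite description in \<open>completion_dist\<close>: the limit exists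
  and is the same for all representatives. Facts about the completed distance then follow by passing
  to limits.\<close>

lemma tendsto_completion_dist:
  assumes "MCauchy s" "MCauchy t"
  shows "(\<lambda>n. d (s n) (t n)) \<longlonglongrightarrow> D (cls s) (cls t)"
proof -
  obtain r where r: "(\<lambda>n. d (s n) (t n)) \<longlonglongrightarrow> r"
    using MCauchy_dist_convergent assms unfolding convergent_def by blast
  have self: "s \<in> cls s" "t \<in> cls t"
    using equiv_class_self[OF equiv_cauchy_rel] assms by auto
  have "(THE r. \<forall>s'\<in>cls s. \<forall>t'\<in>cls t. (\<lambda>n. d (s' n) (t' n)) \<longlonglongrightarrow> r) = r"
  proof (rule the_equality)
    show "\<forall>s'\<in>cls s. \<forall>t'\<in>cls t. (\<lambda>n. d (s' n) (t' n)) \<longlonglongrightarrow> r"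
    proof (intro ballI)
      fix s' t' assume "s' \<in> cls s" "t' \<in> cls t"
      then show "(\<lambda>n. d (s' n) (t' n)) \<longlonglongrightarrow> r"
        using tendsto_dist_transfer[of s t s' t' r] r by (auto simp: cauchy_rel_iff MCauchy_def)
    qed
    show "r' = r" if "\<forall>s'\<in>cls s. \<forall>t'\<in>cls t. (\<lambda>n. d (s' n) (t' n)) \<longlonglongrightarrow> r'" for r'
      using that self r LIMSEQ_unique by blast
  qed
  then show ?thesis
    using r cls_in_completion assms by (simp add: completion_dist_def)
qed

lemma Metric_space_completion: "Metric_space C D"
proof
  have out: "D A B = 0" if "A \<notin> C \<or> B \<notin> C" for A B
    using that by (auto simp: completion_dist_def)
  show "0 \<le> D A B" for A B
  proof (cases "A \<in> C \<and> B \<in> C")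
    case True
    then obtain s t where "MCauchy s" "A = cls s" "MCauchy t" "B = cls t"
      using completion_cases by metis
    then show ?thesis using tendsto_completion_dist by (meson LIMSEQ_le_const nonneg)
  qed (use out in auto)
  show "D A B = D B A" for A B
  proof (cases "A \<in> C \<and> B \<in> C")
    case True
    then obtain s t where st: "MCauchy s" "A = cls s" "MCauchy t" "B = cls t"
      using completion_cases by metis
    then have "(\<lambda>n. d (s n) (t n)) \<longlonglongrightarrow> D B A"
      using tendsto_completion_dist[of t s] by (simp add: commute)
    then show ?thesis using st tendsto_completion_dist[of s t] LIMSEQ_unique by blast
  qed (use out in auto)
  show "D A B = 0 \<longleftrightarrow> A = B" if AB: "A \<in> C" "B \<in> C" for A B
  proof -
    obtain s t where st: "MCauchy s" "A = cls s" "MCauchy t" "B = cls t"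
      using completion_cases AB by metis
    have lim: "(\<lambda>n. d (s n) (t n)) \<longlonglongrightarrow> D A B" using st tendsto_completion_dist by blast
    have "D A B = 0 \<longleftrightarrow> (s, t) \<in> cauchy_rel M d"
      using lim LIMSEQ_unique st by (auto simp: cauchy_rel_iff)
    also have "\<dots> \<longleftrightarrow> A = B"
      using eq_equiv_class_iff[OF equiv_cauchy_rel] st by auto
    finally show ?thesis .
  qed
  show "D A E \<le> D A B + D B E" if ABE: "A \<in> C" "B \<in> C" "E \<in> C" for A B E
  proof -
    obtain s t u where st: "MCauchy s" "A = cls s" "MCauchy t" "B = cls t" "MCauchy u" "E = cls u"
      using completion_cases ABE by metis
    have "(\<lambda>n. d (s n) (t n) + d (t n) (u n)) \<longlonglongrightarrow> D A B + D B E"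
      using st by (intro tendsto_add) (simp_all add: tendsto_completion_dist)
    then show ?thesis
      using st tendsto_completion_dist[of s u] MCauchy_in
      by (intro LIMSEQ_le) (auto intro: triangle)
  qed
qed

lemma embed_eq_cls: "embed M d x = cls (\<lambda>_. x)"
  by (simp add: embed_def)

lemma embed_in_completion: "x \<in> M \<Longrightarrow> embed M d x \<in> C"
  using cls_in_completion[of "\<lambda>_. x"] by (simp add: embed_eq_cls)

lemma completion_dist_embed:
  "\<lbrakk>x \<in> M; y \<in> M\<rbrakk> \<Longrightarrow> D (embed M d x) (embed M d y) = d x y"
  using tendsto_completion_dist[of "\<lambda>_. x" "\<lambda>_. y"]
  by (simp add: embed_eq_cls LIMSEQ_const_iff)

lemma inj_on_embed: "inj_on (embed M d) M"
proof (rule inj_onI)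
  fix x y assume xy: "x \<in> M" "y \<in> M" "embed M d x = embed M d y"
  then have "d x y = d x x" using completion_dist_embed[of x y] completion_dist_embed[of x x] by metis
  then show "x = y" using xy zero[of x y] zero[of x x] by simp
qed

lemma isometric_path_embed:
  "isometric_path M d I \<gamma> \<Longrightarrow> isometric_path C D I (\<lambda>t. embed M d (\<gamma> t))"
  unfolding isometric_path_def
  by (auto simp: embed_in_completion completion_dist_embed image_subset_iff)

lemma continuous_map_embed: "continuous_map mtopology (completion_topology M d) (embed M d)"
proof -
  interpret C: Metric_space C D by (rule Metric_space_completion)
  show ?thesis
    unfolding C.continuous_map_to_metric
  proof (intro ballI allI impI)
    fix x and e :: real assume "x \<in> topspace mtopology" "e > 0"
    then show "\<exists>U. openin mtopology U \<and> x \<in> U \<and> (\<forall>y\<in>U. embed M d y \<in> C.mball (embed M d x) e)"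
      by (intro exI[of _ "mball x e"]) (auto simp: embed_in_completion completion_dist_embed)
  qed
qed

end

context tree_metric begin

text \<open>The interpolating points of approximating pairs form a Cauchy sequence by the four-point
  condition, so no completeness of the completion is needed.\<close>

lemma completion_interpolation:
  assumes "A \<in> C" "B \<in> C" "0 \<le> t" "t \<le> D A B"
  shows "\<exists>E\<in>C. D A E = t \<and> D E B = D A B - t"
proof -
  obtain s u where su: "MCauchy s" "A = cls s" "MCauchy u" "B = cls u"
    using completion_cases assms by metis
  have M: "s n \<in> M" "u n \<in> M" for n using su MCauchy_in by auto
  \<comment> \<open>Although \<open>t \<le> D A B\<close>, an approximating distance
    \<open>d (s n) (u n)\<close> may be smaller than \<open>t\<close>, so \<open>t\<close> is
    truncated; the truncation disappears in the limit.\<close>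
  define \<tau> where "\<tau> n = min t (d (s n) (u n))" for n
  have "\<exists>z. z \<in> M \<and> d (s n) z = \<tau> n \<and> d z (u n) = d (s n) (u n) - \<tau> n" for n
    using interpolation[of "s n" "u n" "\<tau> n"] M assms(3) by (auto simp: \<tau>_def)
  then obtain p where p: "\<And>n. p n \<in> M" "\<And>n. d (s n) (p n) = \<tau> n"
    "\<And>n. d (p n) (u n) = d (s n) (u n) - \<tau> n" by metis
  have lim: "(\<lambda>n. d (s n) (u n)) \<longlonglongrightarrow> D A B" using su tendsto_completion_dist by blast
  have tau: "\<tau> \<longlonglongrightarrow> t"
    using tendsto_min[OF tendsto_const[of t] lim] assms(4) unfolding \<tau>_def by (simp add: min_absorb1)
  have "MCauchy p"
    unfolding MCauchy_def
  proof (intro conjI allI impI)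
    show "range p \<subseteq> M" using p by blast
    fix e :: real assume "e > 0"
    \<comment> \<open>The worse alternative of the four-point inequality costs
      \<open>\<bar>\<tau> m - \<tau> n\<bar>\<close>, \<open>d (s m) (s n)\<close> and twice
      \<open>d (u m) (u n)\<close>: four quarters.\<close>
    then have e: "e / 4 > 0" by simp
    obtain N1 where N1: "\<And>m n. N1 \<le> m \<Longrightarrow> N1 \<le> n \<Longrightarrow> d (s m) (s n) < e / 4"
      using su e unfolding MCauchy_def by meson
    obtain N2 where N2: "\<And>m n. N2 \<le> m \<Longrightarrow> N2 \<le> n \<Longrightarrow> d (u m) (u n) < e / 4"
      using su e unfolding MCauchy_def by meson
    have "Cauchy \<tau>" using tau by (simp add: LIMSEQ_imp_Cauchy)
    then obtain N3 where N3: "\<And>m n. N3 \<le> m \<Longrightarrow> N3 \<le> n \<Longrightarrow> \<bar>\<tau> m - \<tau> n\<bar> < e / 4"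
      using e unfolding Cauchy_iff real_norm_def by meson
    have "d (p m) (p n) < e" if "max N1 (max N2 N3) \<le> m" "max N1 (max N2 N3) \<le> n" for m n
    proof -
      have small: "d (s m) (s n) < e / 4" "d (u m) (u n) < e / 4" "\<bar>\<tau> m - \<tau> n\<bar> < e / 4"
        using N1[of m n] N2[of m n] N3[of m n] that by auto
      have 4: "d (s m) (u m) + d (p m) (p n)
          \<le> max (d (s m) (p m) + d (u m) (p n)) (d (s m) (p n) + d (u m) (p m))"
        using four_point M p(1) by blast
      have a: "d (u m) (p n) \<le> d (u m) (u n) + (d (s n) (u n) - \<tau> n)"
        using triangle[of "u m" "u n" "p n"] M p(1) p(3)[of n] commute[of "u n" "p n"] by simp
      have b: "d (s m) (p n) \<le> d (s m) (s n) + \<tau> n"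
        using triangle[of "s m" "s n" "p n"] M p(1) p(2)[of n] by simp
      have c: "\<bar>d (s m) (u m) - d (s n) (u n)\<bar> \<le> d (s m) (s n) + d (u m) (u n)"
        using dist_diff_le M by blast
      have f: "d (u m) (p m) = d (s m) (u m) - \<tau> m" using p(3)[of m] commute[of "u m" "p m"] by simp
      show ?thesis using 4 a b c f p(2)[of m] small by linarith
    qed
    then show "\<exists>N. \<forall>n n'. N \<le> n \<longrightarrow> N \<le> n' \<longrightarrow> d (p n) (p n') < e" by blast
  qed
  have "\<tau> \<longlonglongrightarrow> D A (cls p)"
    using tendsto_completion_dist[OF su(1) \<open>MCauchy p\<close>] su(2) p(2) by simp
  then have "D A (cls p) = t" using tau LIMSEQ_unique by blast
  moreover have "(\<lambda>n. d (s n) (u n) - \<tau> n) \<longlonglongrightarrow> D (cls p) B"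
    using tendsto_completion_dist[OF \<open>MCauchy p\<close> su(3)] su(4) p(3) by simp
  then have "D (cls p) B = D A B - t" using tendsto_diff[OF lim tau] LIMSEQ_unique by blast
  ultimately show ?thesis using cls_in_completion[OF \<open>MCauchy p\<close>] by blast
qed

lemma tree_metric_completion: "tree_metric C D"
proof -
  interpret C: Metric_space C D by (rule Metric_space_completion)
  show ?thesis
  proof
    fix A B E F assume "A \<in> C" "B \<in> C" "E \<in> C" "F \<in> C"
    then obtain a b e f where "MCauchy a" "A = cls a" "MCauchy b" "B = cls b"
      "MCauchy e" "E = cls e" "MCauchy f" "F = cls f"
      using completion_cases by metis
    then show "D A B + D E F \<le> max (D A E + D B F) (D A F + D B E)"
      by (intro LIMSEQ_le[of "\<lambda>n. d (a n) (b n) + d (e n) (f n)" _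
            "\<lambda>n. max (d (a n) (e n) + d (b n) (f n)) (d (a n) (f n) + d (b n) (e n))"])
        (auto intro!: tendsto_add tendsto_max tendsto_completion_dist four_point MCauchy_in)
  qed (rule completion_interpolation)
qed

end

text \<open>A copy of \<open>tree_metric\<close> to which the completion is attached: attaching it
  to \<open>tree_metric\<close> itself would in turn demand the completion of the completion, and so
  on.\<close>

locale real_tree = tree_metric

sublocale real_tree \<subseteq> C: tree_metric "completion M d" "completion_dist M d"
  by (rule tree_metric_completion)

section \<open>Rays and ends\<close>

context tree_metric begin

lemma differ_compactly_tails:
  assumes "isometric_path M d {a..} \<gamma>" "a \<le> b"
  shows "differ_compactly mtopology (\<gamma> ` {a..}) (\<gamma> ` {b..})"
proof -
  have "\<gamma> ` {a..} = \<gamma> ` {a..b} \<union> \<gamma> ` {b..}"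
  proof -
    have "{a..} = {a..b} \<union> {b..}" using assms(2) by auto
    then show ?thesis by (metis image_Un)
  qed
  moreover have "compactin mtopology (\<gamma> ` {a..b})"
    by (rule compactin_isometric_path[OF assms(1)]) auto
  ultimately show ?thesis using differ_compactly_Un by metis
qed

text \<open>Far out, a point of \<open>\<gamma>\<close> lies on \<open>\<delta>\<close>, and at the
  same parameter because both rays start at one point. Uniqueness of the arc from the start to it
  gives equality before.\<close>

lemma rays_agree:
  assumes \<gamma>: "isometric_path M d {0..} \<gamma>" and \<delta>: "isometric_path M d {0..} \<delta>" and "\<gamma> 0 = \<delta> 0"
    and "differ_compactly mtopology (\<gamma> ` {0..}) (\<delta> ` {0..})" "t \<ge> 0"
  shows "\<gamma> t = \<delta> t"
proof -
  have "eventually (\<lambda>s. \<gamma> s \<in> \<delta> ` {0..} \<and> s \<ge> t) at_top"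
    using differ_compactly_eventually[OF \<gamma> assms(4)] eventually_ge_at_top eventually_conj by blast
  then obtain s where s: "\<gamma> s \<in> \<delta> ` {0..}" "s \<ge> t"
    using eventually_happens'[OF trivial_limit_at_top_linorder] by blast
  then obtain u where u: "u \<ge> 0" "\<gamma> s = \<delta> u" by auto
  have "d (\<gamma> 0) (\<gamma> s) = s" "d (\<delta> 0) (\<delta> u) = u"
    using isometric_pathD(2)[OF \<gamma>, of 0 s] isometric_pathD(2)[OF \<delta>, of 0 u] u s assms(5) by auto
  then have "u = s" using u(2) assms(3) by metis
  show ?thesis
  proof (rule between_unique[of "\<gamma> 0" _ "\<gamma> s"])
    show "between d (\<gamma> 0) (\<gamma> t) (\<gamma> s)"
      by (rule isometric_path_between(1)[OF \<gamma>]) (use s(2) assms(5) in auto)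
    have "between d (\<delta> 0) (\<delta> t) (\<delta> u)"
      by (rule isometric_path_between(1)[OF \<delta>]) (use u(1) s(2) assms(5) \<open>u = s\<close> in auto)
    then show "between d (\<gamma> 0) (\<delta> t) (\<gamma> s)" using u(2) assms(3) by metis
    have "d (\<gamma> 0) (\<gamma> t) = t" "d (\<delta> 0) (\<delta> t) = t"
      using isometric_pathD(2)[OF \<gamma>, of 0 t] isometric_pathD(2)[OF \<delta>, of 0 t] assms(5) by auto
    then show "d (\<gamma> 0) (\<gamma> t) = d (\<gamma> 0) (\<delta> t)" using assms(3) by metis
  qed (use isometric_pathD(1)[OF \<gamma>] isometric_pathD(1)[OF \<delta>] s(2) assms(5) in auto)
qed

text \<open>The new ray follows the geodesic from \<open>x\<close> to its projection on the given ray.\<close>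

lemma ray_from_point:
  assumes \<gamma>: "isometric_path M d {0..} \<gamma>" and "x \<in> M"
  obtains \<gamma>' where "isometric_path M d {0..} \<gamma>'" "\<gamma>' 0 = x"
    "differ_compactly mtopology (\<gamma>' ` {0..}) (\<gamma> ` {0..})"
proof -
  have M: "\<gamma> t \<in> M" if "t \<ge> 0" for t using isometric_pathD(1)[OF \<gamma>] that by simp
  \<comment> \<open>The projection of \<open>x\<close> is at distance at most
    \<open>d (\<gamma> 0) x\<close> from \<open>\<gamma> 0\<close>. Going one unit further keeps
    \<open>s < u\<close>, so the ray from the projection is tested at the positive parameter
    \<open>u - s\<close>.\<close>
  define u where "u = d (\<gamma> 0) x + 1"
  have u: "u > 0" using nonneg[of "\<gamma> 0" x] unfolding u_def by linarith
  obtain m where m: "m \<in> M" "between d (\<gamma> 0) m x" "between d (\<gamma> 0) m (\<gamma> u)" "between d x m (\<gamma> u)"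
    using median[of "\<gamma> 0" x "\<gamma> u"] M u assms(2) by auto
  define s where "s = d (\<gamma> 0) m"
  have s: "0 \<le> s" "s < u"
    using m(2) nonneg[of m x] nonneg[of "\<gamma> 0" m] unfolding s_def u_def between_def by linarith+
  have "m = \<gamma> s"
  proof (rule between_unique[OF m(3)])
    show "between d (\<gamma> 0) (\<gamma> s) (\<gamma> u)"
      by (rule isometric_path_between(1)[OF \<gamma>]) (use s u in auto)
    show "d (\<gamma> 0) m = d (\<gamma> 0) (\<gamma> s)"
      using isometric_pathD(2)[OF \<gamma>, of 0 s] s by (simp add: s_def)
  qed (use M m s u in auto)
  then have btw: "between d x (\<gamma> (s + 0)) (\<gamma> (s + (u - s)))" using m(4) by simp
  have iso: "isometric_path M d {0..} (\<lambda>t. \<gamma> (s + t))"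
    by (rule isometric_path_shift[OF \<gamma>]) (use s in auto)
  obtain \<gamma>' where \<gamma>': "isometric_path M d {0..} \<gamma>'" "\<gamma>' 0 = x"
    "differ_compactly mtopology (\<gamma>' ` {0..}) ((\<lambda>t. \<gamma> (s + t)) ` {0..})"
    using prepend_ray[OF iso assms(2) _ btw] s by auto
  have "(\<lambda>t. \<gamma> (s + t)) ` {0..} = \<gamma> ` {s..}"
    using image_image[of \<gamma> "(+) s" "{0..}"] by simp
  then have "differ_compactly mtopology (\<gamma>' ` {0..}) (\<gamma> ` {0..})"
    using \<gamma>'(3) differ_compactly_common[OF _ differ_compactly_tails[OF \<gamma> s(1)]] by metis
  then show thesis using that \<gamma>' by blast
qed

end

context real_tree begin

lemma boundary_cases:
  assumes "\<xi> \<in> tree_boundary M d"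
  obtains \<rho> where "isometric_path M d {0..} \<rho>" "\<rho> \<in> \<xi>" "\<xi> = ray_rel M d `` {\<rho>}"
proof -
  obtain \<rho> where "\<rho> \<in> rays M d" "\<xi> = ray_rel M d `` {\<rho>}"
    using assms unfolding tree_boundary_def by (auto elim: quotientE)
  moreover from this have "\<rho> \<in> \<xi>" by (simp add: ray_rel_def differ_compactly_refl)
  ultimately show thesis using that by (simp add: rays_def)
qed

text \<open>One representative suffices, since the representatives of an end agree up to a compact
  set and the continuous embedding preserves this.\<close>

lemma ray_to_end_iff:
  assumes "\<xi> \<in> tree_boundary M d" "\<rho> \<in> \<xi>"
  shows "ray_to_end M d \<gamma> \<xi> \<longleftrightarrow> isometric_path C D {0..} \<gamma> \<and>
    differ_compactly C.mtopology (\<gamma> ` {0..}) (embed M d ` \<rho> ` {0..})"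
proof
  assume "isometric_path C D {0..} \<gamma> \<and>
    differ_compactly C.mtopology (\<gamma> ` {0..}) (embed M d ` \<rho> ` {0..})"
  moreover have "differ_compactly C.mtopology (embed M d ` \<rho> ` {0..}) (embed M d ` \<sigma> ` {0..})"
    if "\<sigma> \<in> \<xi>" for \<sigma>
  proof -
    obtain \<rho>\<^sub>0 where "\<xi> = ray_rel M d `` {\<rho>\<^sub>0}" using boundary_cases assms(1) by metis
    then have "differ_compactly mtopology (\<rho>\<^sub>0 ` {0..}) (\<rho> ` {0..})"
      "differ_compactly mtopology (\<rho>\<^sub>0 ` {0..}) (\<sigma> ` {0..})"
      using assms(2) that by (auto simp: ray_rel_def)
    then show ?thesis
      using differ_compactly_trans differ_compactly_sym
        differ_compactly_image[OF _ continuous_map_embed] by metis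
  qed
  ultimately show "ray_to_end M d \<gamma> \<xi>"
    unfolding ray_to_end_def using differ_compactly_trans by blast
qed (use assms in \<open>auto simp: ray_to_end_def\<close>)

lemma ray_to_end_isometric: "ray_to_end M d \<gamma> \<xi> \<Longrightarrow> isometric_path C D {0..} \<gamma>"
  by (simp add: ray_to_end_def)

lemma ray_to_end_transfer:
  assumes "\<xi> \<in> tree_boundary M d" "ray_to_end M d \<gamma> \<xi>" "isometric_path C D {0..} \<delta>"
    "differ_compactly C.mtopology (\<delta> ` {0..}) (\<gamma> ` {0..})"
  shows "ray_to_end M d \<delta> \<xi>"
proof -
  obtain \<rho> where "\<rho> \<in> \<xi>" using boundary_cases assms(1) by metis
  then show ?thesis
    using assms ray_to_end_iff[OF assms(1) \<open>\<rho> \<in> \<xi>\<close>] differ_compactly_trans by blast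
qed

lemma ray_to_end_unique:
  assumes "\<xi> \<in> tree_boundary M d" "ray_to_end M d \<gamma> \<xi>" "ray_to_end M d \<delta> \<xi>" "\<gamma> 0 = \<delta> 0" "t \<ge> 0"
  shows "\<gamma> t = \<delta> t"
proof -
  obtain \<rho> where "\<rho> \<in> \<xi>" using boundary_cases assms(1) by metis
  then have "differ_compactly C.mtopology (\<gamma> ` {0..}) (\<delta> ` {0..})"
    using assms(2,3) ray_to_end_iff[OF assms(1) \<open>\<rho> \<in> \<xi>\<close>] differ_compactly_common by blast
  then show ?thesis
    by (rule C.rays_agree[rotated 3]) (use assms ray_to_end_isometric in auto)
qed

text \<open>The offset may be negative, as is needed to move the origin along a bi-infinite line;
  this is why \<open>\<gamma>\<close> has to be isometric from \<open>min 0 a\<close> on.\<close>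

lemma ray_to_end_shift:
  assumes "\<xi> \<in> tree_boundary M d" "ray_to_end M d \<gamma> \<xi>" "isometric_path C D {min 0 a..} \<gamma>"
  shows "ray_to_end M d (\<lambda>t. \<gamma> (a + t)) \<xi>"
proof (rule ray_to_end_transfer[OF assms(1,2)])
  show "isometric_path C D {0..} (\<lambda>t. \<gamma> (a + t))"
    by (rule isometric_path_shift[OF assms(3)]) auto
  have img: "(\<lambda>t. \<gamma> (a + t)) ` {0..} = \<gamma> ` {a..}"
    using image_image[of \<gamma> "(+) a" "{0..}"] by simp
  have "differ_compactly C.mtopology (\<gamma> ` {min 0 a..}) (\<gamma> ` {a..})"
    "differ_compactly C.mtopology (\<gamma> ` {min 0 a..}) (\<gamma> ` {0..})"
    using C.differ_compactly_tails[OF assms(3)] by auto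
  then show "differ_compactly C.mtopology ((\<lambda>t. \<gamma> (a + t)) ` {0..}) (\<gamma> ` {0..})"
    unfolding img using differ_compactly_trans differ_compactly_sym by blast
qed

text \<open>A choice is unavoidable because values at negative parameters are free; at nonnegative
  parameters \<open>ray_to_end_unique\<close> determines the ray.\<close>

definition ray where "ray A \<xi> = (SOME \<gamma>. ray_to_end M d \<gamma> \<xi> \<and> \<gamma> 0 = A)"

lemma ray:
  assumes "\<xi> \<in> tree_boundary M d" "A \<in> C"
  shows "ray_to_end M d (ray A \<xi>) \<xi>" "ray A \<xi> 0 = A"
proof -
  obtain \<rho> where \<rho>: "isometric_path M d {0..} \<rho>" "\<rho> \<in> \<xi>" using boundary_cases assms(1) by metis
  have "isometric_path C D {0..} (\<lambda>t. embed M d (\<rho> t))" using isometric_path_embed \<rho>(1) by blast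
  then obtain \<gamma> where "isometric_path C D {0..} \<gamma>" "\<gamma> 0 = A"
    "differ_compactly C.mtopology (\<gamma> ` {0..}) ((\<lambda>t. embed M d (\<rho> t)) ` {0..})"
    using C.ray_from_point assms(2) by metis
  then have "ray_to_end M d \<gamma> \<xi> \<and> \<gamma> 0 = A"
    using ray_to_end_iff[OF assms(1) \<rho>(2)] by (simp add: image_image)
  then have "ray_to_end M d (ray A \<xi>) \<xi> \<and> ray A \<xi> 0 = A"
    unfolding ray_def by (rule someI[where P = "\<lambda>\<gamma>. ray_to_end M d \<gamma> \<xi> \<and> \<gamma> 0 = A"])
  then show "ray_to_end M d (ray A \<xi>) \<xi>" "ray A \<xi> 0 = A" by auto
qed

lemma ray_eqI:
  assumes "\<xi> \<in> tree_boundary M d" "A \<in> C" "ray_to_end M d \<gamma> \<xi>" "\<gamma> 0 = A" "t \<ge> 0"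
  shows "ray A \<xi> t = \<gamma> t"
  using ray_to_end_unique ray assms by metis

section \<open>Segments and directions\<close>

text \<open>A point of the completion on the arc from \<open>A\<close> to \<open>X\<close>, so that all statements about
  directions at \<open>A\<close> reduce to the completion.\<close>

definition proxy where "proxy A X = (case X of Pt E \<Rightarrow> E | End \<xi> \<Rightarrow> ray A \<xi> 1)"

lemma hat_cases:
  assumes "X \<in> hat M d"
  obtains E where "E \<in> C" "X = Pt E" | \<xi> where "\<xi> \<in> tree_boundary M d" "X = End \<xi>"
  using assms unfolding hat_def by blast

lemma Pt_in_hat [simp]: "Pt E \<in> hat M d \<longleftrightarrow> E \<in> C"
  by (auto simp: hat_def)

lemma End_in_hat [simp]: "End \<xi> \<in> hat M d \<longleftrightarrow> \<xi> \<in> tree_boundary M d"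
  by (auto simp: hat_def)

lemma proxy_Pt [simp]: "proxy A (Pt E) = E"
  by (simp add: proxy_def)

lemma proxy_End [simp]: "proxy A (End \<xi>) = ray A \<xi> 1"
  by (simp add: proxy_def)

lemma ray_facts:
  assumes "\<xi> \<in> tree_boundary M d" "A \<in> C"
  shows "isometric_path C D {0..} (ray A \<xi>)" and "t \<ge> 0 \<Longrightarrow> ray A \<xi> t \<in> C"
    and "t \<ge> 0 \<Longrightarrow> D A (ray A \<xi> t) = t"
proof -
  show iso: "isometric_path C D {0..} (ray A \<xi>)" using ray assms ray_to_end_isometric by blast
  show "ray A \<xi> t \<in> C" if "t \<ge> 0" using isometric_pathD(1)[OF iso] that by simp
  show "D A (ray A \<xi> t) = t" if "t \<ge> 0"
    using isometric_pathD(2)[OF iso, of 0 t] ray(2)[OF assms] that by simp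
qed

lemma proxy_facts:
  assumes "A \<in> C" "X \<in> hat M d"
  shows "proxy A X \<in> C" and "X \<noteq> Pt A \<Longrightarrow> proxy A X \<noteq> A"
proof -
  show "proxy A X \<in> C"
    using assms(2) by (cases rule: hat_cases) (auto simp: ray_facts(2) assms(1))
  assume "X \<noteq> Pt A"
  with assms(2) show "proxy A X \<noteq> A"
  proof (cases rule: hat_cases)
    case (2 \<xi>)
    then have "D A (ray A \<xi> 1) = 1" using ray_facts assms(1) by simp
    then show ?thesis using 2 assms(1) by auto
  qed auto
qed

text \<open>The tail after \<open>A\<close> of a ray through \<open>A\<close> is the ray from
  \<open>A\<close>, by uniqueness; conversely the arc from \<open>x\<close> to \<open>A\<close> can
  be prepended to that ray. Parameter 1 stands for any positive one.\<close>

lemma between_Pt_End: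
  assumes "A \<in> C" "x \<in> C" "\<xi> \<in> tree_boundary M d" "x \<noteq> A"
  shows "Pt A \<in> seg M d (Pt x) (End \<xi>) \<longleftrightarrow> between D x A (ray A \<xi> 1)"
proof
  assume "Pt A \<in> seg M d (Pt x) (End \<xi>)"
  then obtain \<gamma> t where \<gamma>: "ray_to_end M d \<gamma> \<xi>" "\<gamma> 0 = x" "t \<ge> 0" "\<gamma> t = A" by auto
  have iso: "isometric_path C D {0..} \<gamma>" using \<gamma> ray_to_end_isometric by blast
  have "ray_to_end M d (\<lambda>u. \<gamma> (t + u)) \<xi>"
    using ray_to_end_shift[OF assms(3) \<gamma>(1)] iso \<gamma>(3) by (simp add: min_absorb1)
  then have "ray A \<xi> 1 = \<gamma> (t + 1)" using ray_eqI[of \<xi> A "\<lambda>u. \<gamma> (t + u)" 1] assms \<gamma> by simp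
  moreover have "between D (\<gamma> 0) (\<gamma> t) (\<gamma> (t + 1))"
    by (rule isometric_path_between(1)[OF iso]) (use \<gamma> in auto)
  ultimately show "between D x A (ray A \<xi> 1)" using \<gamma> by simp
next
  assume "between D x A (ray A \<xi> 1)"
  then have btw: "between D x (ray A \<xi> 0) (ray A \<xi> 1)" using ray assms by simp
  obtain \<gamma> where \<gamma>: "isometric_path C D {0..} \<gamma>" "\<gamma> 0 = x" "\<gamma> (D x (ray A \<xi> 0)) = ray A \<xi> 0"
    "differ_compactly C.mtopology (\<gamma> ` {0..}) (ray A \<xi> ` {0..})"
    using C.prepend_ray[OF ray_facts(1)[OF assms(3,1)] assms(2) _ btw] by auto
  then have "ray_to_end M d \<gamma> \<xi>" using ray_to_end_transfer ray assms by blast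
  moreover have "\<gamma> (D x A) = A" using \<gamma>(3) ray(2)[OF assms(3,1)] by simp
  ultimately show "Pt A \<in> seg M d (Pt x) (End \<xi>)" using \<gamma>(2) C.nonneg[of x A]
    by (auto intro!: exI[of _ "D x A"] exI[of _ \<gamma>])
qed

lemma between_End_End:
  assumes "A \<in> C" "\<xi> \<in> tree_boundary M d" "\<eta> \<in> tree_boundary M d"
  shows "Pt A \<in> seg M d (End \<xi>) (End \<eta>) \<longleftrightarrow> between D (ray A \<xi> 1) A (ray A \<eta> 1)"
proof
  assume "Pt A \<in> seg M d (End \<xi>) (End \<eta>)"
  then obtain \<gamma> t where \<gamma>: "isometric_path C D UNIV \<gamma>" "ray_to_end M d \<gamma> \<eta>"
    "ray_to_end M d (\<lambda>s. \<gamma> (- s)) \<xi>" "\<gamma> t = A" by auto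
  have "ray_to_end M d (\<lambda>u. \<gamma> (t + u)) \<eta>"
    by (rule ray_to_end_shift[OF assms(3) \<gamma>(2)]) (use \<gamma>(1) isometric_path_mono in blast)
  then have "ray A \<eta> 1 = \<gamma> (t + 1)" using ray_eqI[of \<eta> A "\<lambda>u. \<gamma> (t + u)" 1] assms \<gamma> by simp
  \<comment> \<open>The reversed line passes through \<open>A\<close> at parameter
    \<open>- t\<close>, so shifting it there yields the ray from \<open>A\<close> to
    \<open>\<xi>\<close>.\<close>
  moreover have "ray_to_end M d (\<lambda>u. \<gamma> (- (- t + u))) \<xi>"
    by (rule ray_to_end_shift[OF assms(2) \<gamma>(3)]) (rule isometric_path_neg[OF \<gamma>(1)], simp)
  then have "ray A \<xi> 1 = \<gamma> (t - 1)"
    using ray_eqI[of \<xi> A "\<lambda>u. \<gamma> (- (- t + u))" 1] assms \<gamma> by simp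
  moreover have "between D (\<gamma> (t - 1)) (\<gamma> t) (\<gamma> (t + 1))"
    by (rule isometric_path_between(1)[OF \<gamma>(1)]) auto
  ultimately show "between D (ray A \<xi> 1) A (ray A \<eta> 1)" using \<gamma> by simp
next
  assume btw: "between D (ray A \<xi> 1) A (ray A \<eta> 1)"
  define \<gamma> where "\<gamma> = (\<lambda>t. if t \<ge> 0 then ray A \<eta> t else ray A \<xi> (- t))"
  have iso: "isometric_path C D UNIV \<gamma>"
    unfolding \<gamma>_def
    by (rule C.rays_to_line) (use btw ray_facts(1) ray(2) assms in auto)
  have "ray_to_end M d \<gamma> \<eta>"
  proof (rule ray_to_end_transfer[OF assms(3) ray(1)[OF assms(3,1)]])
    show "isometric_path C D {0..} \<gamma>" using iso isometric_path_mono by blast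
    have "\<gamma> ` {0..} = ray A \<eta> ` {0..}" by (rule image_cong) (auto simp: \<gamma>_def)
    then show "differ_compactly C.mtopology (\<gamma> ` {0..}) (ray A \<eta> ` {0..})"
      by (simp add: differ_compactly_refl)
  qed
  moreover have "ray_to_end M d (\<lambda>t. \<gamma> (- t)) \<xi>"
  proof (rule ray_to_end_transfer[OF assms(2) ray(1)[OF assms(2,1)]])
    show "isometric_path C D {0..} (\<lambda>t. \<gamma> (- t))" by (rule isometric_path_neg[OF iso]) simp
    have "\<gamma> (- t) = ray A \<xi> t" if "t \<in> {0..}" for t
      using that ray(2)[OF assms(2,1)] ray(2)[OF assms(3,1)] by (cases "t = 0") (auto simp: \<gamma>_def)
    then have "(\<lambda>t. \<gamma> (- t)) ` {0..} = ray A \<xi> ` {0..}" by (rule image_cong[OF refl])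
    then show "differ_compactly C.mtopology ((\<lambda>t. \<gamma> (- t)) ` {0..}) (ray A \<xi> ` {0..})"
      by (simp add: differ_compactly_refl)
  qed
  moreover have "A = \<gamma> 0" using ray(2)[OF assms(3,1)] by (simp add: \<gamma>_def)
  ultimately show "Pt A \<in> seg M d (End \<xi>) (End \<eta>)" using iso by auto
qed

lemma seg_iff_between:
  assumes "A \<in> C" "X \<in> hat M d" "Y \<in> hat M d" "X \<noteq> Pt A" "Y \<noteq> Pt A"
  shows "Pt A \<in> seg M d X Y \<longleftrightarrow> between D (proxy A X) A (proxy A Y)"
  using assms(2)
proof (cases rule: hat_cases)
  case X: (1 x)
  from assms(3) show ?thesis
  proof (cases rule: hat_cases)
    case (1 y)
    then have "Pt A \<in> seg M d X Y \<longleftrightarrow> A \<in> arc C D x y" using X by auto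
    also have "\<dots> \<longleftrightarrow> between D x A y" using C.arc_eq_between[of x y] X 1 assms(1) by auto
    finally show ?thesis using X 1 by simp
  next
    case (2 \<eta>) then show ?thesis using between_Pt_End[of A x \<eta>] X assms(1,4) by simp
  qed
next
  case X: (2 \<xi>)
  from assms(3) show ?thesis
  proof (cases rule: hat_cases)
    case (1 y)
    have "seg M d (End \<xi>) (Pt y) = seg M d (Pt y) (End \<xi>)" by simp
    moreover have "Pt A \<in> seg M d (Pt y) (End \<xi>) \<longleftrightarrow> between D y A (ray A \<xi> 1)"
      by (rule between_Pt_End) (use X 1 assms(1,5) in auto)
    ultimately show ?thesis
      using C.between_commute[of y A "ray A \<xi> 1"] unfolding X 1 by simp
  next
    case (2 \<eta>) then show ?thesis using between_End_End[of A \<xi> \<eta>] X assms(1) by simp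
  qed
qed

lemma direction_Pt_iff:
  assumes "A \<in> C" "X \<in> hat M d" "X \<noteq> Pt A"
  shows "R \<in> direction M d (Pt A) X \<longleftrightarrow>
    R \<in> hat M d \<and> R \<noteq> Pt A \<and> \<not> between D (proxy A X) A (proxy A R)"
  using assms seg_iff_between unfolding direction_def by blast

text \<open>A segment contains ends only as its endpoints, so an end never lies between
  \<open>X\<close> and a point of the completion.\<close>

lemma Pt_in_direction_End:
  assumes "X \<in> hat M d" "X \<noteq> End \<xi>" "E \<in> C"
  shows "Pt E \<in> direction M d (End \<xi>) X"
  using assms by (cases X) (auto simp: direction_def)

section \<open>The observers' topology\<close>

abbreviation obs where "obs \<equiv> observers_topology M d"

lemma topspace_obs [simp]: "topspace obs = hat M d"
  unfolding observers_topology_def by (auto simp: direction_def)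

lemma openin_direction:
  "\<lbrakk>P \<in> hat M d; Q \<in> hat M d; P \<noteq> Q\<rbrakk> \<Longrightarrow> openin obs (direction M d P Q)"
  unfolding observers_topology_def by (rule topology_generated_by_Basis) blast

text \<open>A direction at a point \<open>A\<close> pulls back to an open side of \<open>A\<close>,
  a direction at an end to the whole completion. Through this map, connected sets of the completion
  become connected in the observers' topology.\<close>

lemma continuous_map_Pt: "continuous_map C.mtopology obs Pt"
  unfolding observers_topology_def
proof (rule continuous_on_generated_topo)
  fix U assume "U \<in> insert (hat M d) {direction M d P Q |P Q. P \<in> hat M d \<and> Q \<in> hat M d \<and> P \<noteq> Q}"
  then consider "U = hat M d" | P Q where "U = direction M d P Q" "P \<in> hat M d" "Q \<in> hat M d" "P \<noteq> Q"
    by blast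
  then show "openin C.mtopology (Pt -` U \<inter> topspace C.mtopology)"
  proof cases
    case 1
    then have "Pt -` U \<inter> topspace C.mtopology = topspace C.mtopology" by auto
    then show ?thesis by (metis openin_topspace)
  next
    case U: (2 P Q)
    from U(2) show ?thesis
    proof (cases rule: hat_cases)
      case A: (1 A)
      have "Q \<noteq> Pt A" using U(4) A(2) by blast
      then have "Pt -` U \<inter> topspace C.mtopology = {x \<in> C. x \<noteq> A \<and> \<not> between D (proxy A Q) A x}"
        unfolding U(1) A(2) by (auto simp: direction_Pt_iff[OF A(1) U(3)])
      then show ?thesis using C.openin_between(1)[OF proxy_facts(1)[OF A(1) U(3)] A(1)] by simp
    next
      case End: (2 \<xi>)
      have "Q \<noteq> End \<xi>" using U(4) End(2) by blast
      then have "Pt -` U \<inter> topspace C.mtopology = topspace C.mtopology"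
        unfolding U(1) End(2) using Pt_in_direction_End[OF U(3)] by auto
      then show ?thesis by (metis openin_topspace)
    qed
  qed
qed auto

lemma eventually_ray_in_direction:
  assumes "P \<in> hat M d" "Q \<in> hat M d" "P \<noteq> Q" "\<eta> \<in> tree_boundary M d"
    and "End \<eta> \<in> direction M d P Q" and \<gamma>: "ray_to_end M d \<gamma> \<eta>"
  shows "eventually (\<lambda>t. Pt (\<gamma> t) \<in> direction M d P Q) at_top"
proof -
  have iso: "isometric_path C D {0..} \<gamma>" using \<gamma> ray_to_end_isometric by blast
  then have M: "\<gamma> t \<in> C" if "t \<ge> 0" for t using isometric_pathD(1) that by force
  from assms(1) show ?thesis
  proof (cases rule: hat_cases)
    case (2 \<xi>)
    then have "\<forall>t\<ge>0. Pt (\<gamma> t) \<in> direction M d P Q"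
      using Pt_in_direction_End M assms by auto
    then show ?thesis using eventually_at_top_linorder by blast
  next
    case (1 A)
    let ?r = "ray A \<eta>"
    obtain \<rho> where "\<rho> \<in> \<eta>" using boundary_cases assms(4) by metis
    then have "differ_compactly C.mtopology (\<gamma> ` {0..}) (?r ` {0..})"
      using \<gamma> ray(1)[OF assms(4) 1(1)] ray_to_end_iff[OF assms(4) \<open>\<rho> \<in> \<eta>\<close>]
        differ_compactly_common by blast
    \<comment> \<open>Far points of \<open>\<gamma>\<close> lie on the ray from \<open>A\<close>.
      The extra unit guarantees a parameter \<open>u \<ge> 1\<close> there, and \<open>A\<close>
      does not separate such a point from the proxy \<open>ray A \<eta> 1\<close>.\<close>
    then have "eventually (\<lambda>t. \<gamma> t \<in> ?r ` {0..} \<and> t \<ge> D A (\<gamma> 0) + 1) at_top"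
      using C.differ_compactly_eventually[OF iso] eventually_ge_at_top eventually_conj by blast
    then show ?thesis
    proof (rule eventually_mono)
      fix t assume t: "\<gamma> t \<in> ?r ` {0..} \<and> t \<ge> D A (\<gamma> 0) + 1"
      then obtain u where u: "u \<ge> 0" "\<gamma> t = ?r u" by auto
      have t0: "t \<ge> 0" using t C.nonneg[of A "\<gamma> 0"] by linarith
      have "D (\<gamma> 0) (\<gamma> t) = t" using isometric_pathD(2)[OF iso, of 0 t] t0 by simp
      moreover have "D (\<gamma> 0) (\<gamma> t) \<le> D (\<gamma> 0) A + D A (\<gamma> t)"
        using C.triangle M t0 1(1) by simp
      moreover have "D A (\<gamma> t) = u" using ray_facts(3) assms(4) 1(1) u by simp
      ultimately have "u \<ge> 1" using t C.commute[of A "\<gamma> 0"] by linarith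
      have not1: "\<not> between D (proxy A Q) A (?r 1)"
        using direction_Pt_iff[of A Q "End \<eta>"] assms 1 by simp
      have "\<not> between D (?r 1) A (?r u)"
        using isometric_pathD(2)[OF ray_facts(1)[OF assms(4) 1(1)], of 1 u] \<open>u \<ge> 1\<close>
          ray_facts(3)[OF assms(4) 1(1)] C.commute[of "?r 1" A] by (simp add: between_def)
      then have "\<not> between D (proxy A Q) A (?r u)"
        using not1 C.between_split[of "proxy A Q" A "?r u" "?r 1"] proxy_facts(1) ray_facts(2)
          assms 1 u by auto
      moreover have "?r u \<noteq> A"
        using ray_facts(3)[OF assms(4) 1(1) u(1)] \<open>u \<ge> 1\<close> 1(1) by auto
      ultimately show "Pt (\<gamma> t) \<in> direction M d P Q"
        using direction_Pt_iff[of A Q "Pt (\<gamma> t)"] assms(2,3) 1 u ray_facts(2)[OF assms(4) 1(1)] by simp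
    qed
  qed
qed

text \<open>Holding eventually survives finite intersections and arbitrary unions, so induction over
  the generated topology reduces the claim to directions.\<close>

lemma eventually_ray_in_open:
  assumes "openin obs U" "\<eta> \<in> tree_boundary M d" "End \<eta> \<in> U" and \<gamma>: "ray_to_end M d \<gamma> \<eta>"
  shows "eventually (\<lambda>t. Pt (\<gamma> t) \<in> U) at_top"
proof -
  have "generate_topology_on
      (insert (hat M d) {direction M d P Q |P Q. P \<in> hat M d \<and> Q \<in> hat M d \<and> P \<noteq> Q}) U"
    using assms(1) unfolding observers_topology_def by (rule openin_topology_generated_by)
  then have "End \<eta> \<in> U \<longrightarrow> eventually (\<lambda>t. Pt (\<gamma> t) \<in> U) at_top"
  proof induction
    case (Int U V)
    then show ?case by (auto intro: eventually_conj)
  next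
    case (UN K)
    show ?case
    proof
      assume "End \<eta> \<in> \<Union>K"
      then obtain V where "V \<in> K" "End \<eta> \<in> V" by blast
      then have "eventually (\<lambda>t. Pt (\<gamma> t) \<in> V) at_top" using UN by blast
      then show "eventually (\<lambda>t. Pt (\<gamma> t) \<in> \<Union>K) at_top"
        by (rule eventually_mono) (use \<open>V \<in> K\<close> in blast)
    qed
  next
    case (Basis V)
    then consider "V = hat M d" | P Q where "V = direction M d P Q" "P \<in> hat M d" "Q \<in> hat M d" "P \<noteq> Q"
      by blast
    then show ?case
    proof cases
      case 1
      have "\<forall>t\<ge>0. Pt (\<gamma> t) \<in> V"
        using isometric_pathD(1)[OF ray_to_end_isometric[OF \<gamma>]] 1 by simp
      then show ?thesis using eventually_at_top_linorder by blast
    next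
      case 2
      then show ?thesis using eventually_ray_in_direction assms(2) \<gamma> by blast
    qed
  qed simp
  then show ?thesis using assms(3) by blast
qed

text \<open>The image of the completion is connected, and dense because every end is a limit of the
  points of a ray. Any set between a connected set and its closure is connected.\<close>

lemma connectedin_hat_minus_End: "connectedin obs (hat M d - {End \<xi>})"
proof (rule connectedin_intermediate_closure_of)
  show "connectedin obs (Pt ` C)"
    by (rule connectedin_continuous_map_image[OF continuous_map_Pt C.connectedin_mspace])
  show "Pt ` C \<subseteq> hat M d - {End \<xi>}" by auto
  have "X \<in> obs closure_of Pt ` C" if "X \<in> hat M d" for X
  proof -
    have "\<exists>Y. Y \<in> Pt ` C \<and> Y \<in> U" if U: "X \<in> U" "openin obs U" for U
      using \<open>X \<in> hat M d\<close>
    proof (cases rule: hat_cases)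
      case (2 \<eta>)
      obtain \<rho> where \<rho>: "isometric_path M d {0..} \<rho>" "\<rho> \<in> \<eta>" using boundary_cases 2(1) by metis
      define A where "A = embed M d (\<rho> 0)"
      have A: "A \<in> C" using isometric_pathD(1)[OF \<rho>(1)] embed_in_completion by (simp add: A_def)
      have "eventually (\<lambda>t. Pt (ray A \<eta> t) \<in> U) at_top"
        using eventually_ray_in_open U 2 ray(1)[OF 2(1) A] by blast
      then have "eventually (\<lambda>t. Pt (ray A \<eta> t) \<in> U \<and> t \<ge> 0) at_top"
        using eventually_ge_at_top eventually_conj by blast
      then obtain t where "Pt (ray A \<eta> t) \<in> U" "t \<ge> 0"
        using eventually_happens'[OF trivial_limit_at_top_linorder] by blast
      then show ?thesis using ray_facts(2)[OF 2(1) A] by blast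
    qed (use U in blast)
    then show ?thesis using that by (auto simp: in_closure_of)
  qed
  then show "hat M d - {End \<xi>} \<subseteq> obs closure_of Pt ` C" by blast
qed

text \<open>Otherwise the direction of \<open>X\<close> at \<open>A\<close> and the union of the
  directions of all points outside it would be open sets splitting \<open>S\<close>; they are
  disjoint by \<open>between_split\<close>.\<close>

lemma connectedin_avoiding_Pt:
  assumes "A \<in> C" "connectedin obs S" "Pt A \<notin> S" "X \<in> S" "Y \<in> S"
  shows "\<not> between D (proxy A X) A (proxy A Y)"
proof
  assume btw: "between D (proxy A X) A (proxy A Y)"
  have S: "S \<subseteq> hat M d" using assms(2) connectedin_subset_topspace by fastforce
  let ?U = "direction M d (Pt A) X"
  let ?V = "\<Union>R \<in> {R \<in> hat M d. R \<noteq> Pt A \<and> R \<notin> ?U}. direction M d (Pt A) R"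
  have X: "X \<in> hat M d" "X \<noteq> Pt A" "Y \<in> hat M d" "Y \<noteq> Pt A" using S assms by auto
  have self: "R \<in> direction M d (Pt A) R" if "R \<in> hat M d" "R \<noteq> Pt A" for R
    using direction_Pt_iff[of A R R] that assms(1) proxy_facts[of A R]
      C.between_self_iff[of "proxy A R" A] by simp
  have "openin obs ?U" by (rule openin_direction) (use X assms in auto)
  moreover have "openin obs ?V"
    by (rule openin_Union) (use openin_direction assms(1) in auto)
  moreover have "S \<subseteq> ?U \<union> ?V" using S assms(3) self by blast
  moreover have "?U \<inter> ?V \<inter> S = {}"
  proof -
    have False if "R \<in> hat M d" "R \<noteq> Pt A" "R \<notin> ?U" "Z \<in> ?U" "Z \<in> direction M d (Pt A) R" for R Z
    proof -
      have Z: "Z \<in> hat M d" "\<not> between D (proxy A X) A (proxy A Z)" "\<not> between D (proxy A R) A (proxy A Z)"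
        "between D (proxy A X) A (proxy A R)"
        using that direction_Pt_iff X assms(1) by auto
      have "between D (proxy A X) A (proxy A Z) \<or> between D (proxy A Z) A (proxy A R)"
        by (rule C.between_split[OF Z(4)]) (use proxy_facts(1) Z(1) that X assms in auto)
      then show False using Z C.between_commute by blast
    qed
    then show ?thesis by blast
  qed
  moreover have "X \<in> ?U \<inter> S" using self X assms by blast
  moreover have "Y \<notin> ?U" using direction_Pt_iff X assms(1) btw by simp
  then have "Y \<in> ?V \<inter> S" using self X assms by blast
  ultimately show False using assms(2) unfolding connectedin by blast
qed

lemma connectedin_seg:
  assumes "x \<in> C" "y \<in> C"
  shows "connectedin obs (Pt ` {z \<in> C. between D x z y})"
  by (rule connectedin_continuous_map_image[OF continuous_map_Pt C.connectedin_arc[OF assms]])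

section \<open>Interior points\<close>

lemma embed_eq_iff: "\<lbrakk>x \<in> M; y \<in> M\<rbrakk> \<Longrightarrow> embed M d x = embed M d y \<longleftrightarrow> x = y"
  using inj_on_embed by (auto simp: inj_on_def)

lemma interior_tree_iff:
  "P \<in> interior_tree M d \<longleftrightarrow> (\<exists>a\<in>M. \<exists>x\<in>M. \<exists>y\<in>M.
    P = Pt (embed M d a) \<and> x \<noteq> a \<and> y \<noteq> a \<and> between d x a y)"
proof -
  have "extremal M d (Pt (embed M d a)) \<longleftrightarrow>
      \<not> (\<exists>x\<in>M. \<exists>y\<in>M. x \<noteq> a \<and> y \<noteq> a \<and> between d x a y)" if "a \<in> M" for a
  proof -
    have "{x \<in> M. Pt (embed M d x) \<noteq> Pt (embed M d a)} = M - {a}"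
      using that by (auto simp: embed_eq_iff)
    then show ?thesis using connectedin_minus_point_iff[OF that] by (simp add: extremal_def)
  qed
  then show ?thesis unfolding interior_tree_def by blast
qed

end

section \<open>Transporting betweenness to another metric\<close>

lemma continuous_on_mono_onto:
  fixes h :: "real \<Rightarrow> real"
  assumes "a \<le> b" and mono: "\<And>x y. \<lbrakk>a \<le> x; x \<le> y; y \<le> b\<rbrakk> \<Longrightarrow> h x \<le> h y"
    and onto: "{h a..h b} \<subseteq> h ` {a..b}"
  shows "continuous_on {a..b} h"
proof -
  \<comment> \<open>Continued with slope one on both sides, the function maps onto the whole line,
    and a monotone function with open image is continuous.\<close>
  define k where "k x = (if x < a then h a + (x - a) else if x \<le> b then h x else h b + (x - b))" for x
  have "mono k"
  proof (rule monoI)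
    fix x y :: real assume "x \<le> y"
    then show "k x \<le> k y"
      using mono[of a y] mono[of x y] mono[of a b] mono[of x b] assms(1) unfolding k_def by auto
  qed
  have "surj k"
    unfolding surj_def
  proof
    fix y
    consider "y < h a" | "y \<in> {h a..h b}" | "y > h b" by fastforce
    then show "\<exists>x. y = k x"
    proof cases
      case 1 then show ?thesis by (intro exI[of _ "a + (y - h a)"]) (simp add: k_def)
    next
      case 2
      then obtain x where "x \<in> {a..b}" "h x = y" using onto by blast
      then show ?thesis by (intro exI[of _ x]) (auto simp: k_def)
    next
      case 3 then show ?thesis
        using assms(1) by (intro exI[of _ "b + (y - h b)"]) (simp add: k_def)
    qed
  qed
  then have "continuous_on UNIV k"
    by (intro continuous_onI_mono) (use \<open>mono k\<close> in \<open>auto simp: mono_def\<close>)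
  then have "continuous_on {a..b} k" using continuous_on_subset by blast
  then show ?thesis by (rule continuous_on_cong[THEN iffD1, rotated 2]) (auto simp: k_def)
qed

text \<open>Here \<open>m\<close> lies on both arcs from \<open>w\<close> but need not be the
  median, so only the triangle inequality through \<open>m\<close> is available.\<close>

lemma (in Metric_space) gromov_product_ge:
  assumes "between d w m x" "between d w m y" "m \<in> M" "x \<in> M" "y \<in> M"
  shows "d w m \<le> gromov_product d w x y"
  using assms triangle[of x m y] commute[of x m] by (simp add: between_def gromov_product_def)

lemma (in Metric_space) gromov_product_median:
  assumes "between d w m x" "between d w m y" "between d x m y"
  shows "gromov_product d w x y = d w m"
  using assms commute[of x m] by (simp add: between_def gromov_product_def)

text \<open>Both medians of \<open>(w, x, y)\<close> and \<open>(w, y, z)\<close> lie on the arc from \<open>w\<close> to \<open>y\<close>; the one closer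
  to \<open>w\<close> also lies on the arcs from \<open>w\<close> to \<open>x\<close> and \<open>z\<close>.\<close>

lemma R_tree_if_betweenness:
  assumes "Metric_space S d"
    and median: "\<And>x y z. \<lbrakk>x \<in> S; y \<in> S; z \<in> S\<rbrakk> \<Longrightarrow> \<exists>m\<in>S. B x m y \<and> B x m z \<and> B y m z"
    and trans: "\<And>w x y z. \<lbrakk>B w x y; B w y z; w \<in> S; x \<in> S; y \<in> S; z \<in> S\<rbrakk> \<Longrightarrow> B w x z"
    and linear: "\<And>w x y z. \<lbrakk>B w x z; B w y z; w \<in> S; x \<in> S; y \<in> S; z \<in> S\<rbrakk> \<Longrightarrow> B w x y \<or> B w y x"
    and B: "\<And>x y z. \<lbrakk>B x y z; x \<in> S; y \<in> S; z \<in> S\<rbrakk> \<Longrightarrow> between d x y z"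
    and interpolation: "\<And>x y t. \<lbrakk>x \<in> S; y \<in> S; 0 \<le> t; t \<le> d x y\<rbrakk> \<Longrightarrow>
      \<exists>z\<in>S. d x z = t \<and> d z y = d x y - t"
  shows "R_tree S d"
proof -
  interpret Metric_space S d by fact
  have "min (gromov_product d w x y) (gromov_product d w y z) \<le> gromov_product d w x z"
    if S: "w \<in> S" "x \<in> S" "y \<in> S" "z \<in> S" for w x y z
  proof -
    obtain m where m: "m \<in> S" "B w m x" "B w m y" "B x m y" using median S by metis
    obtain n where n: "n \<in> S" "B w n y" "B w n z" "B y n z" using median S by metis
    have gm: "gromov_product d w x y = d w m"
      by (rule gromov_product_median) (use m S B in blast)+
    have gn: "gromov_product d w y z = d w n"
      by (rule gromov_product_median) (use n S B in blast)+
    consider "B w m n" | "B w n m" using linear m(1,3) n(1,2) S by blast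
    then show ?thesis
    proof cases
      case 1
      then have "B w m z" using trans m n S by blast
      then have "d w m \<le> gromov_product d w x z"
        by (intro gromov_product_ge) (use m S B in blast)+
      then show ?thesis using gm by simp
    next
      case 2
      then have "B w n x" using trans m n S by blast
      then have "d w n \<le> gromov_product d w x z"
        by (intro gromov_product_ge) (use n S B in blast)+
      then show ?thesis using gn by simp
    qed
  qed
  then have "tree_metric S d"
    unfolding gromov_inequality_iff by unfold_locales (use interpolation in blast)+
  then show ?thesis by (simp add: tree_metric_iff_R_tree)
qed

section \<open>Homeomorphisms between observers' topologies\<close>

context real_tree begin

lemma hat_dist_nonneg: "0 \<le> hat_dist M d P Q"
  by (cases P; cases Q) auto

lemma hat_dist_commute: "hat_dist M d P Q = hat_dist M d Q P"
  by (cases P; cases Q) (auto intro: C.commute)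

lemma hat_dist_embed:
  "\<lbrakk>x \<in> M; y \<in> M\<rbrakk> \<Longrightarrow> hat_dist M d (Pt (embed M d x)) (Pt (embed M d y)) = d x y"
  by (simp add: completion_dist_embed)

lemma between_embed:
  "\<lbrakk>x \<in> M; y \<in> M; z \<in> M\<rbrakk> \<Longrightarrow>
    between D (embed M d x) (embed M d y) (embed M d z) \<longleftrightarrow> between d x y z"
  by (simp add: between_def completion_dist_embed)

lemma interior_tree_between:
  assumes "Pt (embed M d x) \<in> interior_tree M d" "Pt (embed M d z) \<in> interior_tree M d"
    "x \<in> M" "y \<in> M" "z \<in> M" "between d x y z"
  shows "Pt (embed M d y) \<in> interior_tree M d"
proof (cases "y = x \<or> y = z")
  case False
  then show ?thesis unfolding interior_tree_iff using assms(3-) by metis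
qed (use assms in auto)

lemma interior_treeE:
  assumes "P \<in> interior_tree M d"
  obtains x where "x \<in> M" "P = Pt (embed M d x)"
  using assms unfolding interior_tree_iff by blast

end

locale obs_homeomorphism = T0: real_tree M d + T1: real_tree N e
  for M :: "'a set" and d and N :: "'b set" and e +
  fixes f :: "'a hat_point \<Rightarrow> 'b hat_point"
  assumes homeo: "homeomorphic_map (observers_topology M d) (observers_topology N e) f"
begin

abbreviation C0 where "C0 \<equiv> completion M d"
abbreviation C1 where "C1 \<equiv> completion N e"
abbreviation D0 where "D0 \<equiv> completion_dist M d"
abbreviation D1 where "D1 \<equiv> completion_dist N e"

lemma image_hat: "f ` hat M d = hat N e"
  using homeomorphic_imp_surjective_map[OF homeo] by simp

lemma inj_on_hat: "inj_on f (hat M d)"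
  using homeomorphic_imp_injective_map[OF homeo] by simp

lemma connectedin_preimage:
  assumes "connectedin T1.obs S"
  shows "connectedin T0.obs {X \<in> hat M d. f X \<in> S}"
proof -
  have "S \<subseteq> f ` hat M d"
    using connectedin_subset_topspace[OF assms] image_hat by simp
  then have "f ` {X \<in> hat M d. f X \<in> S} = S" by blast
  moreover have "connectedin T1.obs (f ` {X \<in> hat M d. f X \<in> S}) \<longleftrightarrow>
      connectedin T0.obs {X \<in> hat M d. f X \<in> S}"
    by (rule homeomorphic_map_connectedness[OF homeo]) auto
  ultimately show ?thesis using assms by simp
qed

text \<open>If \<open>f (Pt a)\<close> missed the target arc, the preimage of that arc would be a
  connected set joining the endpoints without passing through \<open>a\<close>.\<close>

lemma image_between:
  assumes "x \<in> C0" "y \<in> C0" "a \<in> C0" "x' \<in> C1" "y' \<in> C1" "f (Pt x) = Pt x'" "f (Pt y) = Pt y'"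
    and "between D0 x a y"
  shows "f (Pt a) \<in> Pt ` {z \<in> C1. between D1 x' z y'}"
proof (rule ccontr)
  let ?S = "Pt ` {z \<in> C1. between D1 x' z y'}"
  assume "f (Pt a) \<notin> ?S"
  moreover have "f (Pt x) \<in> ?S" "f (Pt y) \<in> ?S"
    using assms by (auto simp: between_def)
  ultimately have "\<not> between D0 (T0.proxy a (Pt x)) a (T0.proxy a (Pt y))"
    by (intro T0.connectedin_avoiding_Pt[OF assms(3)
          connectedin_preimage[OF T1.connectedin_seg[OF assms(4,5)]]]) (use assms in auto)
  then show False using assms(8) by simp
qed

text \<open>Dual to \<open>image_between\<close>: if \<open>z\<close> were missed, the image of the
  source arc would be a connected set avoiding \<open>z\<close> although \<open>z\<close> separates
  its points \<open>x'\<close> and \<open>y'\<close>. The surjectivity of \<open>d_1\<close> along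
  arcs rests on this.\<close>

lemma preimage_between:
  assumes "x \<in> C0" "y \<in> C0" "x' \<in> C1" "y' \<in> C1" "f (Pt x) = Pt x'" "f (Pt y) = Pt y'"
    and "z \<in> C1" "between D1 x' z y'"
  shows "\<exists>a\<in>C0. between D0 x a y \<and> f (Pt a) = Pt z"
proof (rule ccontr)
  let ?S = "Pt ` {a \<in> C0. between D0 x a y}"
  assume none: "\<not> ?thesis"
  have con: "connectedin T1.obs (f ` ?S)"
    by (rule connectedin_continuous_map_image[OF homeomorphic_imp_continuous_map[OF homeo]
          T0.connectedin_seg[OF assms(1,2)]])
  have notin: "Pt z \<notin> f ` ?S"
  proof
    assume "Pt z \<in> f ` ?S"
    then obtain a where "a \<in> C0" "between D0 x a y" "f (Pt a) = Pt z" by fastforce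
    then show False using none by blast
  qed
  have "Pt x \<in> ?S" "Pt y \<in> ?S" using assms(1,2) by (auto simp: between_def)
  from this[THEN imageI[where f = f]]
  have "Pt x' \<in> f ` ?S" "Pt y' \<in> f ` ?S" unfolding assms(5,6) .
  then have "\<not> between D1 (T1.proxy z (Pt x')) z (T1.proxy z (Pt y'))"
    by (rule T1.connectedin_avoiding_Pt[OF assms(7) con notin])
  then show False using assms(8) by simp
qed

text \<open>Needed before distances of images mean anything, because \<open>hat_dist\<close> has the
  default value 0 at ends. If \<open>f P\<close> were an end, the preimage of its connected
  complement would join \<open>x\<close> to \<open>y\<close> while avoiding the point between
  them.\<close>

lemma interior_tree_image:
  assumes "P \<in> interior_tree M d"
  obtains c where "c \<in> C1" "f P = Pt c"
proof -
  obtain a x y where a: "a \<in> M" "x \<in> M" "y \<in> M" "P = Pt (embed M d a)" "x \<noteq> a" "y \<noteq> a" "between d x a y"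
    using assms unfolding T0.interior_tree_iff by blast
  let ?h = "\<lambda>u. Pt (embed M d u)"
  have hat: "?h a \<in> hat M d" "?h x \<in> hat M d" "?h y \<in> hat M d"
    using a T0.embed_in_completion by auto
  then have "f (?h a) \<in> hat N e" using image_hat by blast
  then show thesis
  proof (cases rule: T1.hat_cases)
    case (1 c) then show ?thesis using that a by simp
  next
    case (2 \<xi>)
    have neq: "?h x \<noteq> ?h a" "?h y \<noteq> ?h a" using a T0.embed_eq_iff by auto
    then have "f (?h x) \<noteq> End \<xi>" "f (?h y) \<noteq> End \<xi>"
      using 2 hat inj_on_hat by (metis inj_onD)+
    moreover have "f (?h x) \<in> hat N e" "f (?h y) \<in> hat N e" using hat image_hat by blast+
    ultimately have "\<not> between D0 (T0.proxy (embed M d a) (?h x)) (embed M d a)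
        (T0.proxy (embed M d a) (?h y))"
      by (intro T0.connectedin_avoiding_Pt[OF T0.embed_in_completion[OF a(1)]
            connectedin_preimage[OF T1.connectedin_hat_minus_End[of \<xi>]]]) (use 2 hat in auto)
    then show ?thesis using a T0.between_embed by simp
  qed
qed

lemma hat_dist_image_between:
  assumes "P \<in> interior_tree M d" "Q \<in> interior_tree M d" "R \<in> interior_tree M d"
    and "between (hat_dist M d) P Q R"
  shows "between (hat_dist N e) (f P) (f Q) (f R)"
proof -
  obtain p q r where M: "p \<in> M" "P = Pt (embed M d p)" "q \<in> M" "Q = Pt (embed M d q)"
    "r \<in> M" "R = Pt (embed M d r)"
    using T0.interior_treeE assms(1-3) by metis
  obtain p' r' where N: "p' \<in> C1" "f P = Pt p'" "r' \<in> C1" "f R = Pt r'"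
    using interior_tree_image assms(1,3) by metis
  have "between D0 (embed M d p) (embed M d q) (embed M d r)"
    using assms(4) M by (simp add: between_def)
  then have "f Q \<in> Pt ` {z \<in> C1. between D1 p' z r'}"
    using image_between[of "embed M d p" "embed M d r" "embed M d q" p' r']
      T0.embed_in_completion M N by simp
  then show ?thesis using N by (auto simp: between_def)
qed

text \<open>Yields betweenness for \<open>d_0\<close> in place of the remaining distance:
  betweenness is inherited by \<open>d_1\<close>, so both distances add up and the remaining
  distance follows.\<close>

lemma combination_interpolation:
  assumes P: "P \<in> interior_tree M d" and Q: "Q \<in> interior_tree M d" and l: "l \<in> {0..1}"
  defines "\<delta> \<equiv> \<lambda>P Q. l * hat_dist N e (f P) (f Q) + (1 - l) * hat_dist M d P Q"
  assumes t: "0 \<le> t" "t \<le> \<delta> P Q"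
  shows "\<exists>R\<in>interior_tree M d. \<delta> P R = t \<and> between (hat_dist M d) P R Q"
proof -
  obtain x where x: "x \<in> M" "P = Pt (embed M d x)" using T0.interior_treeE P by metis
  obtain y where y: "y \<in> M" "Q = Pt (embed M d y)" using T0.interior_treeE Q by metis
  obtain x' where x': "x' \<in> C1" "f P = Pt x'" using interior_tree_image P by metis
  obtain y' where y': "y' \<in> C1" "f Q = Pt y'" using interior_tree_image Q by metis
  obtain \<gamma> where \<gamma>: "geodesic_from_to M d x y \<gamma>" using T0.exists_geodesic x y by metis
  define L where "L = d x y"
  define G where "G = (\<lambda>s. Pt (embed M d (\<gamma> s)))"
  \<comment> \<open>The \<open>d_1\<close>-distance from the start as a function of the
    \<open>d_0\<close>-arc length; the combined distance along the arc is
    \<open>l * h s + (1 - l) * s\<close>.\<close>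
  define h where "h = (\<lambda>s. hat_dist N e (f P) (f (G s)))"
  have L: "0 \<le> L" by (simp add: L_def)
  have ends: "G 0 = P" "G L = Q" using \<gamma> x y by (auto simp: G_def L_def geodesic_from_to_def)
  have \<gamma>M: "\<gamma> s \<in> M" "d x (\<gamma> s) = s" "between d x (\<gamma> s) y" if "s \<in> {0..L}" for s
    using T0.geodesic_between[OF \<gamma>] that by (auto simp: L_def)
  have G: "G s \<in> interior_tree M d" if "s \<in> {0..L}" for s
    unfolding G_def using T0.interior_tree_between P Q x y \<gamma>M[OF that] by blast
  have G_between: "between (hat_dist M d) P (G s) (G u)" if "0 \<le> s" "s \<le> u" "u \<le> L" for s u
  proof -
    have "d (\<gamma> s) (\<gamma> u) = u - s"
      using \<gamma> isometric_pathD(2)[of M d "{0..L}" \<gamma> s u] that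
      by (simp add: geodesic_from_to_def L_def)
    then have "between d x (\<gamma> s) (\<gamma> u)" using \<gamma>M[of s] \<gamma>M[of u] that by (simp add: between_def)
    then show ?thesis
      using x \<gamma>M(1)[of s] \<gamma>M(1)[of u] that by (simp add: between_def G_def T0.completion_dist_embed)
  qed
  have h_mono: "h s \<le> h u" if "0 \<le> s" "s \<le> u" "u \<le> L" for s u
  proof -
    have "between (hat_dist N e) (f P) (f (G s)) (f (G u))"
      by (rule hat_dist_image_between) (use P G G_between that in auto)
    then show ?thesis
      using T1.hat_dist_nonneg[of "f (G s)" "f (G u)"] by (simp add: h_def between_def)
  qed
  have h0: "h 0 = 0" using x' by (simp add: h_def ends)
  have hL: "h L = D1 x' y'" using x' y' by (simp add: h_def ends)
  have "{h 0..h L} \<subseteq> h ` {0..L}"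
  proof
    fix r assume "r \<in> {h 0..h L}"
    then obtain z where z: "z \<in> C1" "D1 x' z = r" "D1 z y' = D1 x' y' - r"
      using T1.C.interpolation[of x' y' r] x' y' h0 hL by auto
    have C0: "embed M d x \<in> C0" "embed M d y \<in> C0" using x y T0.embed_in_completion by auto
    have "between D1 x' z y'" using z by (simp add: between_def)
    then obtain a where a: "a \<in> C0" "between D0 (embed M d x) a (embed M d y)" "f (Pt a) = Pt z"
      using preimage_between[OF C0 x'(1) y'(1) _ _ z(1)] x y x' y' by auto
    define s where "s = D0 (embed M d x) a"
    have s: "s \<in> {0..L}"
      using a(2) T0.C.nonneg[of "embed M d x" a] T0.C.nonneg[of a "embed M d y"]
        T0.completion_dist_embed[of x y] x y
      unfolding s_def L_def between_def atLeastAtMost_iff by linarith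
    \<comment> \<open>The preimage \<open>a\<close> is a priori only a point of the completion. The
      completion adds nothing to an arc with endpoints in \<open>M\<close>, since
      \<open>\<gamma>\<close> already supplies a point at each distance.\<close>
    have "a = embed M d (\<gamma> s)"
    proof (rule T0.C.between_unique[OF a(2)])
      show "between D0 (embed M d x) (embed M d (\<gamma> s)) (embed M d y)"
        using T0.between_embed x y \<gamma>M[OF s] by simp
      show "D0 (embed M d x) a = D0 (embed M d x) (embed M d (\<gamma> s))"
        using T0.completion_dist_embed[of x "\<gamma> s"] x \<gamma>M[OF s] s_def by simp
    qed (use C0 a(1) \<gamma>M(1)[OF s] T0.embed_in_completion in auto)
    then have "h s = r" using a(3) x' z(2) by (simp add: h_def G_def)
    then show "r \<in> h ` {0..L}" using s by blast
  qed
  then have "continuous_on {0..L} h" using continuous_on_mono_onto L h_mono by blast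
  then have "continuous_on {0..L} (\<lambda>s. l * h s + (1 - l) * s)" by (intro continuous_intros)
  moreover have "l * h L + (1 - l) * L = \<delta> P Q"
    using hL x' y' x y by (simp add: \<delta>_def L_def T0.completion_dist_embed)
  ultimately obtain s where s: "0 \<le> s" "s \<le> L" "l * h s + (1 - l) * s = t"
    using IVT'[of "\<lambda>s. l * h s + (1 - l) * s" 0 t L] t L h0 by auto
  have "\<delta> P (G s) = t"
    using s \<gamma>M[of s] x by (simp add: \<delta>_def h_def G_def T0.completion_dist_embed)
  then show ?thesis using G G_between[of s L] s ends by auto
qed

text \<open>Each summand's distance vanishes exactly on the diagonal, for \<open>d_1\<close> by
  injectivity of \<open>f\<close>. Definiteness thus holds also for \<open>l = 0\<close> and
  \<open>l = 1\<close>, where one weight is zero.\<close>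

lemma Metric_space_combination:
  assumes "l \<in> {0..1}"
  shows "Metric_space (interior_tree M d)
    (\<lambda>P Q. l * hat_dist N e (f P) (f Q) + (1 - l) * hat_dist M d P Q)"
proof
  fix P Q
  show "0 \<le> l * hat_dist N e (f P) (f Q) + (1 - l) * hat_dist M d P Q"
    using assms T0.hat_dist_nonneg T1.hat_dist_nonneg by simp
  show "l * hat_dist N e (f P) (f Q) + (1 - l) * hat_dist M d P Q =
      l * hat_dist N e (f Q) (f P) + (1 - l) * hat_dist M d Q P"
    using T0.hat_dist_commute T1.hat_dist_commute by metis
next
  fix P Q assume PQ: "P \<in> interior_tree M d" "Q \<in> interior_tree M d"
  obtain x where x: "x \<in> M" "P = Pt (embed M d x)" using T0.interior_treeE PQ by metis
  obtain y where y: "y \<in> M" "Q = Pt (embed M d y)" using T0.interior_treeE PQ by metis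
  obtain x' where x': "x' \<in> C1" "f P = Pt x'" using interior_tree_image PQ by metis
  obtain y' where y': "y' \<in> C1" "f Q = Pt y'" using interior_tree_image PQ by metis
  have hat: "P \<in> hat M d" "Q \<in> hat M d" using x y T0.embed_in_completion by auto
  have 0: "hat_dist M d P Q = 0 \<longleftrightarrow> P = Q"
    using x y T0.zero[of x y] T0.embed_eq_iff[of x y] T0.hat_dist_embed[of x y] by simp
  have "hat_dist N e (f P) (f Q) = 0 \<longleftrightarrow> f P = f Q" using x' y' by simp
  also have "\<dots> \<longleftrightarrow> P = Q" using inj_on_hat hat by (auto dest: inj_onD)
  finally have 1: "hat_dist N e (f P) (f Q) = 0 \<longleftrightarrow> P = Q" .
  have "l * hat_dist N e (f P) (f Q) \<ge> 0" "(1 - l) * hat_dist M d P Q \<ge> 0"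
    using assms T0.hat_dist_nonneg T1.hat_dist_nonneg by auto
  then show "l * hat_dist N e (f P) (f Q) + (1 - l) * hat_dist M d P Q = 0 \<longleftrightarrow> P = Q"
    using 0 1 by (auto simp: add_nonneg_eq_0_iff)
next
  fix P Q R assume PQR: "P \<in> interior_tree M d" "Q \<in> interior_tree M d" "R \<in> interior_tree M d"
  obtain x y z where x: "x \<in> M" "P = Pt (embed M d x)" "y \<in> M" "Q = Pt (embed M d y)"
    "z \<in> M" "R = Pt (embed M d z)" using T0.interior_treeE PQR by metis
  obtain x' y' z' where x': "x' \<in> C1" "f P = Pt x'" "y' \<in> C1" "f Q = Pt y'" "z' \<in> C1" "f R = Pt z'"
    using interior_tree_image PQR by metis
  have "hat_dist N e (f P) (f R) \<le> hat_dist N e (f P) (f Q) + hat_dist N e (f Q) (f R)"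
    using x' T1.C.triangle by simp
  then have "l * hat_dist N e (f P) (f R) \<le> l * (hat_dist N e (f P) (f Q) + hat_dist N e (f Q) (f R))"
    using assms by (intro mult_left_mono) auto
  moreover have "hat_dist M d P R \<le> hat_dist M d P Q + hat_dist M d Q R"
    using x T0.triangle[of x y z] by (simp add: T0.completion_dist_embed)
  then have "(1 - l) * hat_dist M d P R \<le> (1 - l) * (hat_dist M d P Q + hat_dist M d Q R)"
    using assms by (intro mult_left_mono) auto
  ultimately show "l * hat_dist N e (f P) (f R) + (1 - l) * hat_dist M d P R
      \<le> l * hat_dist N e (f P) (f Q) + (1 - l) * hat_dist M d P Q +
        (l * hat_dist N e (f Q) (f R) + (1 - l) * hat_dist M d Q R)"
    by (simp add: distrib_left)
qed

text \<open>The betweenness of \<open>d_0\<close> serves as the abstract relation for every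
  \<open>l\<close>: its medians and its order on arcs do not depend on \<open>l\<close>, and it
  implies betweenness for the combined metric.\<close>

lemma R_tree_combination:
  assumes l: "l \<in> {0..1}"
  shows "R_tree (interior_tree M d)
    (\<lambda>P Q. l * hat_dist N e (f P) (f Q) + (1 - l) * hat_dist M d P Q)"
    (is "R_tree ?I ?\<delta>")
proof (rule R_tree_if_betweenness[where B = "between (hat_dist M d)"])
  let ?h = "\<lambda>x. Pt (embed M d x)"
  show "Metric_space ?I ?\<delta>" by (rule Metric_space_combination[OF l])
  have between_h: "between (hat_dist M d) (?h x) (?h y) (?h z) \<longleftrightarrow> between d x y z"
    if "x \<in> M" "y \<in> M" "z \<in> M" for x y z
    using that by (simp add: between_def T0.completion_dist_embed)
  have B: "between ?\<delta> P Q R"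
    if "between (hat_dist M d) P Q R" "P \<in> ?I" "Q \<in> ?I" "R \<in> ?I" for P Q R
  proof -
    have "hat_dist N e (f P) (f R) = hat_dist N e (f P) (f Q) + hat_dist N e (f Q) (f R)"
      using hat_dist_image_between[OF that(2-4,1)] by (simp add: between_def)
    moreover have "hat_dist M d P R = hat_dist M d P Q + hat_dist M d Q R"
      using that(1) by (simp add: between_def)
    ultimately show ?thesis by (simp add: between_def algebra_simps)
  qed
  then show "between ?\<delta> P Q R"
    if "between (hat_dist M d) P Q R" "P \<in> ?I" "Q \<in> ?I" "R \<in> ?I" for P Q R
    using that by blast
  show "\<exists>m\<in>?I. between (hat_dist M d) P m Q \<and> between (hat_dist M d) P m R
      \<and> between (hat_dist M d) Q m R"
    if I: "P \<in> ?I" "Q \<in> ?I" "R \<in> ?I" for P Q R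
  proof -
    obtain x y z where x: "x \<in> M" "P = ?h x" "y \<in> M" "Q = ?h y" "z \<in> M" "R = ?h z"
      using T0.interior_treeE I by metis
    obtain m where m: "m \<in> M" "between d x m y" "between d x m z" "between d y m z"
      using T0.median x by metis
    \<comment> \<open>The median stays in the interior tree because it lies between the interior
      points \<open>P\<close> and \<open>Q\<close>.\<close>
    have "?h m \<in> ?I" by (rule T0.interior_tree_between[of x y]) (use m x I in auto)
    then show ?thesis
      by (rule bexI[rotated]) (use m x between_h in simp)
  qed
  show "between (hat_dist M d) W P R"
    if "between (hat_dist M d) W P Q" "between (hat_dist M d) W Q R"
      and I: "W \<in> ?I" "P \<in> ?I" "Q \<in> ?I" "R \<in> ?I" for W P Q R
  proof -
    obtain w x y z where "w \<in> M" "W = ?h w" "x \<in> M" "P = ?h x" "y \<in> M" "Q = ?h y" "z \<in> M" "R = ?h z"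
      using T0.interior_treeE I by metis
    then show ?thesis
      using that(1,2) T0.between_trans(1)[of w x y z] between_h by simp
  qed
  show "between (hat_dist M d) W P Q \<or> between (hat_dist M d) W Q P"
    if "between (hat_dist M d) W P R" "between (hat_dist M d) W Q R"
      and I: "W \<in> ?I" "P \<in> ?I" "Q \<in> ?I" "R \<in> ?I" for W P Q R
  proof -
    obtain w x y z where "w \<in> M" "W = ?h w" "x \<in> M" "P = ?h x" "y \<in> M" "Q = ?h y" "z \<in> M" "R = ?h z"
      using T0.interior_treeE I by metis
    then show ?thesis
      using that(1,2) T0.between_linear[of w x z y] T0.between_linear[of w y z x] between_h
      by (cases "d w x \<le> d w y") auto
  qed
  show "\<exists>R\<in>?I. ?\<delta> P R = t \<and> ?\<delta> R Q = ?\<delta> P Q - t"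
    if PQ: "P \<in> ?I" "Q \<in> ?I" and t: "0 \<le> t" "t \<le> ?\<delta> P Q" for P Q t
  proof -
    obtain R where R: "R \<in> ?I" "?\<delta> P R = t" "between (hat_dist M d) P R Q"
      using combination_interpolation[OF PQ l t] by blast
    then have "between ?\<delta> P R Q" using B PQ by blast
    then have "?\<delta> R Q = ?\<delta> P Q - t" using R(2) unfolding between_def by linarith
    then show ?thesis using R by blast
  qed
qed

end

text \<open>The identified interior tree is represented inside the hat of \<open>T0\<close>, and
  \<open>d1\<close> is pulled back to it along \<open>f\<close>.\<close>

theorem proposition3p1:
  fixes N :: nat
    and T0 :: "'a set" and d0 :: "'a \<Rightarrow> 'a \<Rightarrow> real" and \<phi>0 :: "letter list \<Rightarrow> 'a \<Rightarrow> 'a"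
    and T1 :: "'b set" and d1 :: "'b \<Rightarrow> 'b \<Rightarrow> real" and \<phi>1 :: "letter list \<Rightarrow> 'b \<Rightarrow> 'b"
    and f :: "'a hat_point \<Rightarrow> 'b hat_point"
  assumes "N \<ge> 2"
    and "R_tree T0 d0" and "R_tree T1 d1"
    and "isometric_action (free_group N) T0 d0 \<phi>0"
    and "isometric_action (free_group N) T1 d1 \<phi>1"
    and "very_small (free_group N) T0 d0 \<phi>0" and "very_small (free_group N) T1 d1 \<phi>1"
    and "dense_orbits (free_group N) T0 d0 \<phi>0" and "dense_orbits (free_group N) T1 d1 \<phi>1"
    and "dual_lamination N T0 d0 \<phi>0 = dual_lamination N T1 d1 \<phi>1"
    and "homeomorphic_map (observers_topology T0 d0) (observers_topology T1 d1) f"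
    and "\<And>g P. g \<in> carrier (free_group N) \<Longrightarrow> P \<in> hat T0 d0 \<Longrightarrow>
      f (hat_action T0 d0 \<phi>0 g P) = hat_action T1 d1 \<phi>1 g (f P)"
    and "\<And>X. X \<in> free_group_boundary N \<Longrightarrow> f (Qmap N T0 d0 \<phi>0 X) = Qmap N T1 d1 \<phi>1 X"
  shows "\<forall>l\<in>{0..1::real}. R_tree (interior_tree T0 d0)
    (\<lambda>P Q. l * hat_dist T1 d1 (f P) (f Q) + (1 - l) * hat_dist T0 d0 P Q)"
proof -
  have "real_tree T0 d0" "real_tree T1 d1"
    using assms(2,3) by (simp_all add: real_tree_def tree_metric_iff_R_tree)
  then have "obs_homeomorphism T0 d0 T1 d1 f"
    using assms(11) by (simp add: obs_homeomorphism_def obs_homeomorphism_axioms_def)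
  then show ?thesis by (rule obs_homeomorphism.R_tree_combination[THEN ballI])
qed

end
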